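(* Let $n\ge3$. There is an isomorphism of complex vector spaces $$\mathcal P_{n,-1}\otimes_{\mathbb R}\mathbb C\;\simeq\;\mathcal W_n,$$ where $\mathcal P_{n,-1}$ is the real vector space of polynomial relative first-order differential projective invariants of weight $-1$ of $n$ points, and $$\mathcal W_n=\left\{H\in\mathbb C[\mathcal M_n]^{SL(3,\mathbb C)}\;\middle|\;H(\mathbf t\cdot z)=(t_1\cdots t_n)^{-3}H(z)\ \text{ for all }\mathbf t=(t_1,\dots,t_n)\in\mathbb T_n\right\}.$$
   Context: Affine setting. Let $R_n=\mathbb R[x_i,y_i,p_i,q_i\mid i=1,\dots,n]$. For $T=\begin{pmatrix} a_1 & a_2 & a_3 \\ b_1 & b_2 & b_3 \\ c_1 & c_2 & c_3 \end{pmatrix}\in GL(3,\mathbb R)$ and $g=[T]\in PGL(3,\mathbb R)$, put $s_i=c_1x_i+c_2y_i+c_3$. The element $g$ acts (where all $s_i\ne0$) diagonally on $z=(x_i,y_i,p_i,q_i)_{i=1}^n$ by $(x_i,y_i)\mapsto\left(\frac{a_1x_i+a_2y_i+a_3}{s_i},\frac{b_1x_i+b_2y_i+b_3}{s_i}\right)$, with $(p_i,q_i)$ transforming as the first-order partial derivatives of a scalar function at $(x_i,y_i)$. Equivalently, with $A_i=(x_i,y_i,1)^T$ (column) and $\ell_i=(p_i,q_i,-p_ix_i-q_iy_i)$ (row), the action is $A_i\mapsto TA_i/s_i$, $\ell_i\mapsto s_i\ell_iT^{-1}$. Put $J(g)=\frac{(\det T)^n}{\prod_{i=1}^n s_i^3}$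 (a function of $z$). $\mathcal P_{n,-1}$ is the space of all $F\in R_n$ with $F(g\cdot z)=J(g)^{-1}F(z)$ for all $g\in PGL(3,\mathbb R)$ and $z$ for which the action is defined. Homogeneous setting. $\mathcal M_n=\{(A_i,\ell_i)_{i=1}^n\in(\mathbb C^3\oplus(\mathbb C^3)^* )^n\mid \ell_iA_i=0,\ i=1,\dots,n\}$, an affine variety with coordinate ring $\mathbb C[\mathcal M_n]$. $SL(3,\mathbb C)$ acts by $A_i\mapsto GA_i$, $\ell_i\mapsto\ell_iG^{-1}$, and $\mathbb T_n=(\mathbb C^\times)^n$ acts by $A_i\mapsto t_iA_i$, $\ell_i\mapsto t_i^{-1}\ell_i$. *)

theory Defs
  imports
    "HOL-Analysis.Analysis"
    "HOL-Library.Poly_Mapping"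
    "HOL-Library.Set_Algebras"
begin

section \<open>Finitely supported functions as a vector space\<close>

definition pm_scale :: "'k::comm_ring_1 \<Rightarrow> ('a \<Rightarrow>\<^sub>0 'k) \<Rightarrow> ('a \<Rightarrow>\<^sub>0 'k)" where
  "pm_scale c p = Poly_Mapping.map (\<lambda>x. c * x) p"

lemma lookup_pm_scale [simp]:
  "Poly_Mapping.lookup (pm_scale c p) k = c * Poly_Mapping.lookup p k"
  by (auto simp: pm_scale_def Poly_Mapping.map.rep_eq when_def)

lemma vector_space_pm_scale:
  "vector_space (pm_scale :: 'k::field \<Rightarrow> ('a \<Rightarrow>\<^sub>0 'k) \<Rightarrow> _)"
  by unfold_locales (auto intro!: poly_mapping_eqI simp: lookup_add algebra_simps)

lemma module_pm_scale: "module (pm_scale :: 'k::field \<Rightarrow> ('a \<Rightarrow>\<^sub>0 'k) \<Rightarrow> _)"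
  using vector_space_pm_scale by (simp add: module_iff_vector_space)


section \<open>Polynomials\<close>

text \<open>A monomial is an exponent vector, a polynomial assigns coefficients to
  finitely many monomials. Poly\_Mapping supplies the ring structure.\<close>

type_synonym ('v, 'k) mpoly = "('v \<Rightarrow>\<^sub>0 nat) \<Rightarrow>\<^sub>0 'k"

definition mpoly_eval :: "('v \<Rightarrow> 'k::comm_ring_1) \<Rightarrow> ('v, 'k) mpoly \<Rightarrow> 'k" where
  "mpoly_eval z F = (\<Sum>m\<in>Poly_Mapping.keys F.
     Poly_Mapping.lookup F m * (\<Prod>v\<in>Poly_Mapping.keys m. z v ^ Poly_Mapping.lookup m v))"

lemma mpoly_eval_superset:
  assumes "finite S" "Poly_Mapping.keys F \<subseteq> S"
  shows "mpoly_eval z F = (\<Sum>m\<in>S.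
     Poly_Mapping.lookup F m * (\<Prod>v\<in>Poly_Mapping.keys m. z v ^ Poly_Mapping.lookup m v))"
  unfolding mpoly_eval_def using assms
  by (intro sum.mono_neutral_left) (auto simp: in_keys_iff)

lemma mpoly_eval_zero: "mpoly_eval z 0 = 0"
  by (simp add: mpoly_eval_def)

lemma mpoly_eval_add: "mpoly_eval z (F + G) = mpoly_eval z F + mpoly_eval z G"
proof -
  let ?S = "Poly_Mapping.keys F \<union> Poly_Mapping.keys G"
  have "Poly_Mapping.keys (F + G) \<subseteq> ?S" by (rule keys_add)
  then show ?thesis
    by (simp add: mpoly_eval_superset[of ?S] lookup_add distrib_right sum.distrib)
qed

lemma mpoly_eval_scale: "mpoly_eval z (pm_scale c F) = c * mpoly_eval z F"
proof -
  have "Poly_Mapping.keys (pm_scale c F) \<subseteq> Poly_Mapping.keys F"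
    by (auto simp: in_keys_iff)
  then show ?thesis
    by (simp add: mpoly_eval_superset[of "Poly_Mapping.keys F"] sum_distrib_left mult.assoc)
qed


section \<open>Affine setting\<close>

text \<open>The finite type \<open>'n\<close> indexes the points, so \<open>n\<close> is \<open>CARD('n)\<close>. An element of
  \<open>('n aff_var, real) mpoly\<close> is an element of \<open>R\<^sub>n\<close>.\<close>

datatype 'n aff_var = Vx 'n | Vy 'n | Vp 'n | Vq 'n

definition aff_A :: "('n aff_var \<Rightarrow> real) \<Rightarrow> 'n \<Rightarrow> real^3" where
  "aff_A z i = vector [z (Vx i), z (Vy i), 1]"

definition aff_l :: "('n aff_var \<Rightarrow> real) \<Rightarrow> 'n \<Rightarrow> real^3" where
  "aff_l z i = vector [z (Vp i), z (Vq i), - z (Vp i) * z (Vx i) - z (Vq i) * z (Vy i)]"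

definition aff_s :: "real^3^3 \<Rightarrow> ('n aff_var \<Rightarrow> real) \<Rightarrow> 'n \<Rightarrow> real" where
  "aff_s T z i = T $ 3 $ 1 * z (Vx i) + T $ 3 $ 2 * z (Vy i) + T $ 3 $ 3"

text \<open>The first two coordinates of \<open>T A\<^sub>i / s\<^sub>i\<close> and of \<open>s\<^sub>i \<ell>\<^sub>i T\<^sup>-\<^sup>1\<close>; the lemmas
  \<open>aff_A_act\<close> and \<open>aff_l_act\<close> below show that the third coordinates agree as well.\<close>

primrec aff_act :: "real^3^3 \<Rightarrow> ('n aff_var \<Rightarrow> real) \<Rightarrow> 'n aff_var \<Rightarrow> real" where
  "aff_act T z (Vx i) = (T *v aff_A z i) $ 1 / aff_s T z i"
| "aff_act T z (Vy i) = (T *v aff_A z i) $ 2 / aff_s T z i"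
| "aff_act T z (Vp i) = aff_s T z i * (aff_l z i v* matrix_inv T) $ 1"
| "aff_act T z (Vq i) = aff_s T z i * (aff_l z i v* matrix_inv T) $ 2"

definition aff_J :: "real^3^3 \<Rightarrow> ('n::finite aff_var \<Rightarrow> real) \<Rightarrow> real" where
  "aff_J T z = det T ^ CARD('n) / (\<Prod>i\<in>UNIV. aff_s T z i ^ 3)"

text \<open>The space \<open>P\<^sub>n\<^sub>,\<^sub>-\<^sub>1\<close>. An element of \<open>PGL(3)\<close> is given by an invertible representative \<open>T\<close>;
  the lemmas \<open>aff_act_scalar\<close>, \<open>aff_J_scalar\<close> below show independence of the representative.\<close>

definition proj_invariants :: "('n::finite aff_var, real) mpoly set" where
  "proj_invariants = {F. \<forall>T z. invertible T \<longrightarrow> (\<forall>i. aff_s T z i \<noteq> 0) \<longrightarrow>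
     mpoly_eval (aff_act T z) F = inverse (aff_J T z) * mpoly_eval z F}"

lemma subspace_proj_invariants: "module.subspace pm_scale proj_invariants"
  by (rule module.subspaceI[OF module_pm_scale])
    (auto simp: proj_invariants_def mpoly_eval_zero mpoly_eval_add mpoly_eval_scale algebra_simps)

lemma aff_s_eq: "aff_s T z i = (T *v aff_A z i) $ 3"
  by (simp add: aff_s_def aff_A_def matrix_vector_mult_def sum_3)

lemma aff_A_act:
  assumes "aff_s T z i \<noteq> 0"
  shows "aff_A (aff_act T z) i = (1 / aff_s T z i) *s (T *v aff_A z i)"
  using assms
  by (simp add: vec_eq_iff forall_3 aff_A_def[of "aff_act T z"] flip: aff_s_eq)

lemma matrix_inv_both:
  fixes T :: "'k::field^'n^'n"
  assumes "invertible T"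
  shows "T ** matrix_inv T = mat 1" "matrix_inv T ** T = mat 1"
proof -
  have "\<exists>B. T ** B = mat 1 \<and> B ** T = mat 1"
    using assms by (auto simp: invertible_def)
  then have "T ** matrix_inv T = mat 1 \<and> matrix_inv T ** T = mat 1"
    unfolding matrix_inv_def by (rule someI_ex)
  then show "T ** matrix_inv T = mat 1" "matrix_inv T ** T = mat 1" by auto
qed

lemma aff_l_act:
  assumes T: "invertible T" and s: "aff_s T z i \<noteq> 0"
  shows "aff_l (aff_act T z) i = aff_s T z i *s (aff_l z i v* matrix_inv T)"
proof -
  define L where "L = aff_l z i v* matrix_inv T"
  define B where "B = T *v aff_A z i"
  have "inner L B = inner (aff_l z i) (matrix_inv T *v B)"
    unfolding L_def by (simp add: dot_lmul_matrix)
  also have "matrix_inv T *v B = aff_A z i"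
    unfolding B_def by (simp add: matrix_vector_mul_assoc matrix_inv_both[OF T])
  also have "inner (aff_l z i) (aff_A z i) = 0"
    by (simp add: inner_vec_def sum_3 aff_l_def aff_A_def)
  finally have "L $ 1 * B $ 1 + L $ 2 * B $ 2 + L $ 3 * aff_s T z i = 0"
    by (simp add: inner_vec_def sum_3 aff_s_eq B_def)
  then have "L $ 3 * aff_s T z i = - L $ 1 * B $ 1 - L $ 2 * B $ 2" by linarith
  then show ?thesis using s
    by (simp add: vec_eq_iff forall_3 aff_l_def[of "aff_act T z"] mult.commute
        flip: L_def B_def)
qed

lemma matrix_inv_scalar:
  fixes T :: "real^'n^'n"
  assumes T: "invertible T" and c: "c \<noteq> 0"
  shows "matrix_inv (c *\<^sub>R T) = (1 / c) *\<^sub>R matrix_inv T"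
proof -
  have 1: "(c *\<^sub>R T) ** ((1 / c) *\<^sub>R matrix_inv T) = mat 1"
    using c by (simp add: scalar_matrix_assoc[symmetric] matrix_scalar_ac matrix_inv_both[OF T])
  then have "invertible (c *\<^sub>R T)" using invertible_right_inverse by blast
  then have "matrix_inv (c *\<^sub>R T) ** (c *\<^sub>R T) = mat 1" by (rule matrix_inv_both)
  then have "(1 / c) *\<^sub>R matrix_inv T =
      (matrix_inv (c *\<^sub>R T) ** (c *\<^sub>R T)) ** ((1 / c) *\<^sub>R matrix_inv T)" by simp
  also have "\<dots> = matrix_inv (c *\<^sub>R T)"
    by (simp only: matrix_mul_assoc[symmetric] 1 matrix_mul_rid)
  finally show ?thesis ..
qed

lemma aff_s_scalar: "aff_s (c *\<^sub>R T) z i = c * aff_s T z i"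
  by (simp add: aff_s_def algebra_simps)

lemma aff_act_scalar:
  assumes "invertible T" "c \<noteq> 0"
  shows "aff_act (c *\<^sub>R T) z = aff_act T z"
proof
  fix v
  show "aff_act (c *\<^sub>R T) z v = aff_act T z v"
    using assms
    by (cases v) (simp_all add: aff_s_scalar matrix_inv_scalar matrix_vector_mult_def
        vector_matrix_mult_def sum_3 divide_simps algebra_simps)
qed

lemma aff_J_scalar:
  assumes "c \<noteq> 0"
  shows "aff_J (c *\<^sub>R T) z = aff_J T (z :: 'n::finite aff_var \<Rightarrow> real)"
proof -
  have "det (c *\<^sub>R T) = c ^ 3 * det T"
    by (simp add: det_3 algebra_simps power3_eq_cube)
  then show ?thesis using assms
    by (simp add: aff_J_def aff_s_scalar power_mult_distrib prod.distrib)
qed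


section \<open>Homogeneous setting\<close>

text \<open>A point of the ambient space is \<open>z :: 'n \<Rightarrow> (complex^3) \<times> (complex^3)\<close> with
  \<open>z i = (A\<^sub>i, \<ell>\<^sub>i)\<close>; the covector \<open>\<ell>\<^sub>i\<close> is given by its row of coordinates.\<close>

type_synonym 'n hom_point = "'n \<Rightarrow> (complex^3) \<times> (complex^3)"

definition hom_M :: "'n hom_point set" where
  "hom_M = {z. \<forall>i. (\<Sum>j\<in>UNIV. snd (z i) $ j * fst (z i) $ j) = 0}"

datatype 'n hom_var = VA 'n 3 | Vl 'n 3

primrec hom_coord :: "'n hom_point \<Rightarrow> 'n hom_var \<Rightarrow> complex" where
  "hom_coord z (VA i j) = fst (z i) $ j"
| "hom_coord z (Vl i j) = snd (z i) $ j"

text \<open>The coordinate ring of \<open>hom_M\<close>: restrictions of polynomials to \<open>hom_M\<close>. Outside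
  \<open>hom_M\<close> the functions are set to \<open>0\<close>, so that two of them are equal iff they agree on
  \<open>hom_M\<close>, and the vector space operations are the pointwise ones.\<close>

definition hom_coord_ring :: "('n::finite hom_point \<Rightarrow> complex) set" where
  "hom_coord_ring = {H. \<exists>P :: ('n hom_var, complex) mpoly.
     H = (\<lambda>z. if z \<in> hom_M then mpoly_eval (hom_coord z) P else 0)}"

definition SL_act ::
    "complex^3^3 \<Rightarrow> 'n hom_point \<Rightarrow> 'n hom_point" where
  "SL_act G z = (\<lambda>i. (G *v fst (z i), snd (z i) v* matrix_inv G))"

definition torus_act ::
    "('n \<Rightarrow> complex) \<Rightarrow> 'n hom_point \<Rightarrow> 'n hom_point" where
  "torus_act t z = (\<lambda>i. (t i *s fst (z i), inverse (t i) *s snd (z i)))"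

definition hom_SL_invariants :: "('n::finite hom_point \<Rightarrow> complex) set" where
  "hom_SL_invariants =
     {H \<in> hom_coord_ring. \<forall>G. det G = 1 \<longrightarrow> (\<forall>z\<in>hom_M. H (SL_act G z) = H z)}"

definition hom_W :: "('n::finite hom_point \<Rightarrow> complex) set" where
  "hom_W = {H \<in> hom_SL_invariants. \<forall>t. (\<forall>i. t i \<noteq> 0) \<longrightarrow>
     (\<forall>z\<in>hom_M. H (torus_act t z) = inverse ((\<Prod>i\<in>UNIV. t i) ^ 3) * H z)}"


section \<open>Tensor products and extension of scalars\<close>

text \<open>For \<open>k\<close>-vector spaces \<open>V\<close>, \<open>W\<close> (given as subsets, with scalar multiplications \<open>sV\<close>,
  \<open>sW\<close>), \<open>V \<otimes> W\<close> is the free \<open>k\<close>-vector space on \<open>V \<times> W\<close> modulo the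
  bilinearity relations. Its elements are cosets; addition of cosets is the set-theoretic
  sum \<open>X + Y\<close>.\<close>

definition tensor_rels ::
    "('k::field \<Rightarrow> 'v::ab_group_add \<Rightarrow> 'v) \<Rightarrow> 'v set \<Rightarrow> ('k \<Rightarrow> 'w::ab_group_add \<Rightarrow> 'w) \<Rightarrow> 'w set
     \<Rightarrow> ('v \<times> 'w \<Rightarrow>\<^sub>0 'k) set" where
  "tensor_rels sV V sW W =
     {Poly_Mapping.single (u + v, w) 1 - Poly_Mapping.single (u, w) 1 - Poly_Mapping.single (v, w) 1
       | u v w. u \<in> V \<and> v \<in> V \<and> w \<in> W}
   \<union> {Poly_Mapping.single (v, w + x) 1 - Poly_Mapping.single (v, w) 1 - Poly_Mapping.single (v, x) 1
       | v w x. v \<in> V \<and> w \<in> W \<and> x \<in> W}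
   \<union> {Poly_Mapping.single (sV c v, w) 1 - pm_scale c (Poly_Mapping.single (v, w) 1)
       | c v w. v \<in> V \<and> w \<in> W}
   \<union> {Poly_Mapping.single (v, sW c w) 1 - pm_scale c (Poly_Mapping.single (v, w) 1)
       | c v w. v \<in> V \<and> w \<in> W}"

definition tensor_null ::
    "('k::field \<Rightarrow> 'v::ab_group_add \<Rightarrow> 'v) \<Rightarrow> 'v set \<Rightarrow> ('k \<Rightarrow> 'w::ab_group_add \<Rightarrow> 'w) \<Rightarrow> 'w set
     \<Rightarrow> ('v \<times> 'w \<Rightarrow>\<^sub>0 'k) set" where
  "tensor_null sV V sW W = module.span pm_scale (tensor_rels sV V sW W)"

definition tensor_prod ::
    "('k::field \<Rightarrow> 'v::ab_group_add \<Rightarrow> 'v) \<Rightarrow> 'v set \<Rightarrow> ('k \<Rightarrow> 'w::ab_group_add \<Rightarrow> 'w) \<Rightarrow> 'w set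
     \<Rightarrow> ('v \<times> 'w \<Rightarrow>\<^sub>0 'k) set set" where
  "tensor_prod sV V sW W =
     {x +o tensor_null sV V sW W | x. Poly_Mapping.keys x \<subseteq> V \<times> W}"

text \<open>Extension of scalars of a real vector space \<open>V\<close> to the complex numbers, with the
  complex scalar multiplication induced by \<open>a (v \<otimes> b) = v \<otimes> a b\<close>.\<close>

definition complexification ::
    "(real \<Rightarrow> 'v::ab_group_add \<Rightarrow> 'v) \<Rightarrow> 'v set \<Rightarrow> ('v \<times> complex \<Rightarrow>\<^sub>0 real) set set" where
  "complexification sV V = tensor_prod sV V scaleR UNIV"

definition free_cscale ::
    "complex \<Rightarrow> ('v \<times> complex \<Rightarrow>\<^sub>0 real) \<Rightarrow> ('v \<times> complex \<Rightarrow>\<^sub>0 real)" where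
  "free_cscale a x = (\<Sum>(v, b)\<in>Poly_Mapping.keys x.
     Poly_Mapping.single (v, a * b) (Poly_Mapping.lookup x (v, b)))"

definition complexification_scale ::
    "(real \<Rightarrow> 'v::ab_group_add \<Rightarrow> 'v) \<Rightarrow> 'v set \<Rightarrow> complex
     \<Rightarrow> ('v \<times> complex \<Rightarrow>\<^sub>0 real) set \<Rightarrow> ('v \<times> complex \<Rightarrow>\<^sub>0 real) set" where
  "complexification_scale sV V a X =
     (\<Union>x\<in>X. free_cscale a x +o tensor_null sV V scaleR UNIV)"

end

theory Submission
  imports Defs "HOL-Computational_Algebra.Fundamental_Theorem_Algebra"
begin

text \<open>
  Restricting a torus-covariant \<open>SL(3)\<close>-invariant \<open>H\<close> to the slice \<open>w\<^sub>i = 1\<close> (where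
  \<open>A\<^sub>i = (x\<^sub>i, y\<^sub>i, w\<^sub>i)\<close> and \<open>\<ell>\<^sub>i = (p\<^sub>i, q\<^sub>i, r\<^sub>i)\<close>) gives a complex polynomial in the affine
  variables whose real and imaginary parts lie in \<open>P\<^sub>n\<^sub>,\<^sub>-\<^sub>1\<close>: an invertible real \<open>T\<close> is
  \<open>c G\<close> with \<open>det G = 1\<close>, and \<open>T\<close> acts on the slice as \<open>G\<close> followed by the torus element
  \<open>(c / s\<^sub>i)\<^sub>i\<close>.

  Conversely, an affine invariant \<open>F\<close> determines the function
  \<open>H = (\<Prod>w\<^sub>i)\<^sup>-\<^sup>3 F(x\<^sub>i/w\<^sub>i, y\<^sub>i/w\<^sub>i, w\<^sub>ip\<^sub>i, w\<^sub>iq\<^sub>i)\<close> on the dense set where all \<open>w\<^sub>i \<noteq> 0\<close>. By Zariski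
  density of the real points it is invariant under \<open>SL(3, \<complex>)\<close>. Since a unipotent element moves a
  point with \<open>w\<^sub>i = 0\<close> and nonzero \<open>A\<^sub>1, \<dots>, A\<^sub>n\<close> into that dense set, \<open>H\<close> has no pole along
  \<open>w\<^sub>i = 0\<close>: if \<open>(\<Prod>w\<^sub>j^e\<^sub>j) H\<close> is a polynomial and \<open>e\<^sub>i > 0\<close>, then this polynomial vanishes on the
  hypersurface \<open>w\<^sub>i = 0\<close>, and a polynomial with this property is divisible by \<open>w\<^sub>i\<close>. Hence \<open>H\<close> is
  a polynomial.
\<close>

section \<open>Polynomial functions\<close>

text \<open>Polynomiality is a property of functions here, so that closure, substitution and limit
  statements are inductions over three rules. The set \<open>S\<close> records which coordinates may
  occur, which the division by \<open>w_i\<close> relies on.\<close>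

inductive poly_fun :: "'v set \<Rightarrow> (('v \<Rightarrow> 'k::comm_ring_1) \<Rightarrow> 'k) \<Rightarrow> bool" for S where
  const: "poly_fun S (\<lambda>_. c)"
| add: "poly_fun S f \<Longrightarrow> poly_fun S g \<Longrightarrow> poly_fun S (\<lambda>z. f z + g z)"
| var_mult: "v \<in> S \<Longrightarrow> poly_fun S f \<Longrightarrow> poly_fun S (\<lambda>z. z v * f z)"

named_theorems poly_fun_intros

declare poly_fun.const [poly_fun_intros] poly_fun.add [poly_fun_intros]

lemma poly_fun_cmult: "poly_fun S f \<Longrightarrow> poly_fun S (\<lambda>z. c * f z)"
proof (induction rule: poly_fun.induct)
  case (var_mult v f)
  then show ?case
    using poly_fun.var_mult[of v S "\<lambda>z. c * f z"] by (simp add: mult.left_commute)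
qed (auto simp: distrib_left intro: poly_fun.intros)

lemma poly_fun_mult [poly_fun_intros]:
  "poly_fun S f \<Longrightarrow> poly_fun S g \<Longrightarrow> poly_fun S (\<lambda>z. f z * g z)"
proof (induction rule: poly_fun.induct)
  case (const c)
  then show ?case by (rule poly_fun_cmult)
next
  case (var_mult v f)
  then show ?case
    using poly_fun.var_mult[of v S "\<lambda>z. f z * g z"] by (simp add: mult.assoc)
qed (auto simp: distrib_right intro: poly_fun.intros)

lemma poly_fun_var [poly_fun_intros]: "v \<in> S \<Longrightarrow> poly_fun S (\<lambda>z. z v)"
  using poly_fun.var_mult[OF _ poly_fun.const[of S 1]] by simp

lemma poly_fun_uminus [poly_fun_intros]: "poly_fun S f \<Longrightarrow> poly_fun S (\<lambda>z. - f z)"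
  using poly_fun_cmult[of S f "-1"] by simp

lemma poly_fun_diff [poly_fun_intros]:
  "poly_fun S f \<Longrightarrow> poly_fun S g \<Longrightarrow> poly_fun S (\<lambda>z. f z - g z)"
  using poly_fun.add[OF _ poly_fun_uminus] by fastforce

lemma poly_fun_sum [poly_fun_intros]:
  "(\<And>i. i \<in> I \<Longrightarrow> poly_fun S (f i)) \<Longrightarrow> poly_fun S (\<lambda>z. \<Sum>i\<in>I. f i z)"
  by (induction I rule: infinite_finite_induct) (auto intro: poly_fun_intros)

lemma poly_fun_prod [poly_fun_intros]:
  "(\<And>i. i \<in> I \<Longrightarrow> poly_fun S (f i)) \<Longrightarrow> poly_fun S (\<lambda>z. \<Prod>i\<in>I. f i z)"
  by (induction I rule: infinite_finite_induct) (auto intro: poly_fun_intros)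

lemma poly_fun_power [poly_fun_intros]: "poly_fun S f \<Longrightarrow> poly_fun S (\<lambda>z. f z ^ k)"
  by (induction k) (auto intro: poly_fun_intros)

lemma poly_fun_mono: "poly_fun S f \<Longrightarrow> S \<subseteq> S' \<Longrightarrow> poly_fun S' f"
  by (induction rule: poly_fun.induct) (auto intro: poly_fun.intros)

lemma poly_fun_cong_on: "poly_fun S f \<Longrightarrow> (\<And>v. v \<in> S \<Longrightarrow> z v = z' v) \<Longrightarrow> f z = f z'"
  by (induction rule: poly_fun.induct) auto

lemma poly_fun_compose:
  "poly_fun S f \<Longrightarrow> (\<And>v. v \<in> S \<Longrightarrow> poly_fun S' (\<sigma> v)) \<Longrightarrow> poly_fun S' (\<lambda>u. f (\<lambda>v. \<sigma> v u))"
  by (induction rule: poly_fun.induct) (auto intro: poly_fun_intros)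

text \<open>Division with remainder by the coordinate \<open>v\<close>: the remainder
  \<open>g\<close> is free of \<open>v\<close>, while the quotient \<open>h\<close> may still
  contain it.\<close>

lemma poly_fun_split_var:
  assumes "poly_fun S f"
  shows "\<exists>g h. poly_fun (S - {v}) g \<and> poly_fun S h \<and> (\<forall>z. f z = g z + z v * h z)"
  using assms
proof (induction rule: poly_fun.induct)
  case (const c)
  have "poly_fun (S - {v}) (\<lambda>_. c)" "poly_fun S (\<lambda>_. 0)"
    by (rule poly_fun.const)+
  then show ?case by (intro exI[of _ "\<lambda>_. c"] exI[of _ "\<lambda>_. 0"]) simp
next
  case (add f f')
  then obtain g h g' h' where
    "poly_fun (S - {v}) g" "poly_fun S h" "\<forall>z. f z = g z + z v * h z"
    "poly_fun (S - {v}) g'" "poly_fun S h'" "\<forall>z. f' z = g' z + z v * h' z" by blast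
  then show ?case
    by (intro exI[of _ "\<lambda>z. g z + g' z"] exI[of _ "\<lambda>z. h z + h' z"])
      (auto intro: poly_fun_intros simp: algebra_simps)
next
  case (var_mult u f)
  then obtain g h where gh:
    "poly_fun (S - {v}) g" "poly_fun S h" "\<forall>z. f z = g z + z v * h z" by blast
  show ?case
  proof (cases "u = v")
    case True
    then show ?thesis using var_mult(2)
      by (intro exI[of _ "\<lambda>z. 0"] exI[of _ f]) (auto intro: poly_fun_intros)
  next
    case False
    then show ?thesis using gh var_mult(1)
      by (intro exI[of _ "\<lambda>z. z u * g z"] exI[of _ "\<lambda>z. z u * h z"])
        (auto intro!: poly_fun_intros simp: algebra_simps)
  qed
qed

text \<open>The bridge to univariate polynomials: root counting and growth at infinity become
  available along every coordinate line.\<close>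

lemma poly_fun_upd_eq_poly:
  assumes "poly_fun S f"
  shows "\<exists>p. \<forall>t. f (z(v := t)) = poly p t"
  using assms
proof (induction rule: poly_fun.induct)
  case (const c)
  show ?case by (rule exI[of _ "[:c:]"]) simp
next
  case (add f g)
  then show ?case by (metis poly_add)
next
  case (var_mult u f)
  then obtain p where "\<forall>t. f (z(v := t)) = poly p t" by blast
  moreover have "(z(v := t)) u = (if u = v then t else z u)" for t by simp
  ultimately show ?case
    by (intro exI[of _ "if u = v then pCons 0 p else smult (z u) p"]) (auto simp del: fun_upd_apply)
qed

text \<open>This carries the closure arguments on the variety: an equation that holds along a
  punctured curve passes to the limit point of the curve.\<close>

lemma poly_fun_tendsto:
  fixes f :: "('v \<Rightarrow> 'k::{comm_ring_1, real_normed_algebra}) \<Rightarrow> 'k"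
  assumes "poly_fun S f" "\<And>v. v \<in> S \<Longrightarrow> ((\<lambda>t. \<gamma> t v) \<longlongrightarrow> z v) L"
  shows "((\<lambda>t. f (\<gamma> t)) \<longlongrightarrow> f z) L"
  using assms by (induction rule: poly_fun.induct) (auto intro!: tendsto_intros)

text \<open>A product with a coordinate raises the exponent of \<open>d\<close> by one, and a sum is
  put over the product of the two denominators, so a single \<open>N\<close> serves all points of
  \<open>D\<close>.\<close>

lemma poly_fun_clear_denominators:
  fixes f :: "('v \<Rightarrow> 'k::field) \<Rightarrow> 'k"
  assumes "poly_fun S f" and d: "poly_fun S' d"
    and \<sigma>: "\<And>v. v \<in> S \<Longrightarrow> \<exists>g. poly_fun S' g \<and> (\<forall>u\<in>D. \<sigma> v u = g u / d u)"
    and nz: "\<And>u. u \<in> D \<Longrightarrow> d u \<noteq> 0"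
  shows "\<exists>N g. poly_fun S' g \<and> (\<forall>u\<in>D. f (\<lambda>v. \<sigma> v u) = g u / d u ^ N)"
  using assms(1)
proof (induction rule: poly_fun.induct)
  case (const c)
  have "poly_fun S' (\<lambda>_. c)" by (rule poly_fun.const)
  then show ?case by (intro exI[of _ 0] exI[of _ "\<lambda>_. c"]) auto
next
  case (add f f')
  then obtain N g N' g' where g: "poly_fun S' g" "\<forall>u\<in>D. f (\<lambda>v. \<sigma> v u) = g u / d u ^ N"
    "poly_fun S' g'" "\<forall>u\<in>D. f' (\<lambda>v. \<sigma> v u) = g' u / d u ^ N'" by blast
  then have "\<forall>u\<in>D. f (\<lambda>v. \<sigma> v u) + f' (\<lambda>v. \<sigma> v u)
      = (g u * d u ^ N' + g' u * d u ^ N) / d u ^ (N + N')"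
    using nz by (auto simp: divide_simps power_add algebra_simps)
  moreover have "poly_fun S' (\<lambda>u. g u * d u ^ N' + g' u * d u ^ N)"
    using g d by (intro poly_fun_intros)
  ultimately show ?case by blast
next
  case (var_mult v f)
  then obtain N g h where g: "poly_fun S' g" "\<forall>u\<in>D. f (\<lambda>v. \<sigma> v u) = g u / d u ^ N"
    "poly_fun S' h" "\<forall>u\<in>D. \<sigma> v u = h u / d u"
    using \<sigma> by blast
  then have "\<forall>u\<in>D. \<sigma> v u * f (\<lambda>v. \<sigma> v u) = (h u * g u) / d u ^ (Suc N)"
    by auto
  moreover have "poly_fun S' (\<lambda>u. h u * g u)"
    using g by (intro poly_fun_intros)
  ultimately show ?case by blast
qed

section \<open>Formal polynomials and the functions they define\<close>

definition monom_eval :: "('v \<Rightarrow> 'k::comm_ring_1) \<Rightarrow> ('v \<Rightarrow>\<^sub>0 nat) \<Rightarrow> 'k" where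
  "monom_eval z m = (\<Prod>v\<in>Poly_Mapping.keys m. z v ^ Poly_Mapping.lookup m v)"

lemma mpoly_eval_eq: "mpoly_eval z F =
    (\<Sum>m\<in>Poly_Mapping.keys F. Poly_Mapping.lookup F m * monom_eval z m)"
  by (simp add: mpoly_eval_def monom_eval_def)

lemma monom_eval_superset:
  assumes "finite S" "Poly_Mapping.keys m \<subseteq> S"
  shows "monom_eval z m = (\<Prod>v\<in>S. z v ^ Poly_Mapping.lookup m v)"
  unfolding monom_eval_def using assms
  by (intro prod.mono_neutral_left) (auto simp: in_keys_iff)

lemma monom_eval_add: "monom_eval z (m + m') = monom_eval z m * monom_eval z m'"
proof -
  let ?S = "Poly_Mapping.keys m \<union> Poly_Mapping.keys m'"
  show ?thesis
    by (simp add: monom_eval_superset[of ?S] keys_add lookup_add power_add prod.distrib)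
qed

lemma monom_eval_times: "monom_eval (\<lambda>v. z v * z' v) m = monom_eval z m * monom_eval z' m"
  by (simp add: monom_eval_def power_mult_distrib prod.distrib)

text \<open>Monomials are multiplicative characters, so Dedekind's argument shows that distinct ones
  are linearly independent, already on the points with natural coordinates.\<close>

lemma monom_eval_independent:
  fixes a :: "('v \<Rightarrow>\<^sub>0 nat) \<Rightarrow> 'k::field_char_0"
  assumes "finite S" "\<And>z. range z \<subseteq> \<nat> \<Longrightarrow> (\<Sum>m\<in>S. a m * monom_eval z m) = 0" "m \<in> S"
  shows "a m = 0"
  using assms
proof (induction S arbitrary: a m rule: finite_induct)
  case (insert m\<^sub>0 S)
  have *: "a m' = 0" if m': "m' \<in> S" for m'
  proof -
    have "m' \<noteq> m\<^sub>0" using m' insert.hyps(2) by metis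
    then obtain v where v: "Poly_Mapping.lookup m' v \<noteq> Poly_Mapping.lookup m\<^sub>0 v"
      using poly_mapping_eqI[of m' m\<^sub>0] by meson
    \<comment> \<open>The point \<open>w\<close> doubles one coordinate in which the two exponent
      vectors differ, so the two monomials take different powers of 2 at \<open>w\<close>.\<close>
    define w :: "'v \<Rightarrow> 'k" where "w = (\<lambda>_. 1)(v := 2)"
    have w: "monom_eval w n = 2 ^ Poly_Mapping.lookup n v" for n
    proof -
      have "monom_eval w n = (\<Prod>u\<in>insert v (Poly_Mapping.keys n). w u ^ Poly_Mapping.lookup n u)"
        by (rule monom_eval_superset) auto
      also have "\<dots> = (\<Prod>u\<in>{v}. w u ^ Poly_Mapping.lookup n u)"
        by (rule prod.mono_neutral_right) (auto simp: w_def)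
      finally show ?thesis by (simp add: w_def)
    qed
    have wN: "w u \<in> \<nat>" for u by (simp add: w_def)
    have "a m' * (monom_eval w m' - monom_eval w m\<^sub>0) = 0"
    proof (rule insert.IH[OF _ m'])
      fix z :: "'v \<Rightarrow> 'k" assume z: "range z \<subseteq> \<nat>"
      then have wz: "range (\<lambda>v. w v * z v) \<subseteq> \<nat>"
        using wN by (auto intro!: Nats_mult)
      \<comment> \<open>The relation at \<open>w z\<close> minus
        \<open>monom_eval w m\<^sub>0\<close> times the relation at \<open>z\<close> has no
        \<open>m\<^sub>0\<close> term, so it is a relation between the monomials of \<open>S\<close>
        alone.\<close>
      have "(\<Sum>m\<in>S. a m * (monom_eval w m - monom_eval w m\<^sub>0) * monom_eval z m)
          = (\<Sum>m\<in>insert m\<^sub>0 S. a m * monom_eval (\<lambda>v. w v * z v) m)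
            - monom_eval w m\<^sub>0 * (\<Sum>m\<in>insert m\<^sub>0 S. a m * monom_eval z m)"
        using insert.hyps(1,2)
        by (simp add: monom_eval_times sum_distrib_left sum_subtractf algebra_simps)
      then show "(\<Sum>m\<in>S. a m * (monom_eval w m - monom_eval w m\<^sub>0) * monom_eval z m) = 0"
        by (simp only: insert.prems(1)[OF z] insert.prems(1)[OF wz]) simp
    qed
    moreover have "monom_eval w m' \<noteq> monom_eval w m\<^sub>0"
    proof -
      have "(2 :: nat) ^ Poly_Mapping.lookup m' v \<noteq> 2 ^ Poly_Mapping.lookup m\<^sub>0 v"
        using v by simp
      then have "(of_nat (2 ^ Poly_Mapping.lookup m' v) :: 'k)
          \<noteq> of_nat (2 ^ Poly_Mapping.lookup m\<^sub>0 v)"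
        by (simp only: of_nat_eq_iff not_False_eq_True)
      then show ?thesis by (simp add: w)
    qed
    ultimately show ?thesis by simp
  qed
  \<comment> \<open>All other coefficients vanish by now, and at the all-ones point the remaining
    monomial is 1.\<close>
  have "(\<Sum>m\<in>insert m\<^sub>0 S. a m * monom_eval (\<lambda>_. 1) m) = 0"
    by (rule insert.prems(1)) auto
  then have "a m\<^sub>0 = 0" using insert.hyps(1,2) * by (simp add: monom_eval_def)
  then show ?case using insert.prems(2) * by auto
qed simp

lemma mpoly_eq_0:
  fixes F :: "('v, 'k::field_char_0) mpoly"
  assumes "\<And>z. range z \<subseteq> \<nat> \<Longrightarrow> mpoly_eval z F = 0"
  shows "F = 0"
proof (rule poly_mapping_eqI)
  fix m
  show "Poly_Mapping.lookup F m = Poly_Mapping.lookup 0 m"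
    using monom_eval_independent[of "Poly_Mapping.keys F" "Poly_Mapping.lookup F" m] assms
    by (cases "m \<in> Poly_Mapping.keys F") (auto simp: mpoly_eval_eq in_keys_iff)
qed

lemma mpoly_eval_single: "mpoly_eval z (Poly_Mapping.single m a) = a * monom_eval z m"
  by (simp add: mpoly_eval_eq)

lemma mpoly_eval_sum: "mpoly_eval z (\<Sum>i\<in>I. F i) = (\<Sum>i\<in>I. mpoly_eval z (F i))"
  by (induction I rule: infinite_finite_induct) (auto simp: mpoly_eval_zero mpoly_eval_add)

lemma poly_fun_mpoly_eval: "poly_fun UNIV (\<lambda>z. mpoly_eval z F)"
  unfolding mpoly_eval_def by (intro poly_fun_intros) auto

lemma poly_fun_imp_mpoly:
  assumes "poly_fun S f"
  shows "\<exists>F. f = (\<lambda>z. mpoly_eval z F)"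
  using assms
proof (induction rule: poly_fun.induct)
  case (const c)
  show ?case
    by (rule exI[of _ "Poly_Mapping.single 0 c"]) (simp add: mpoly_eval_single monom_eval_def)
next
  case (add f g)
  then obtain F G where "f = (\<lambda>z. mpoly_eval z F)" "g = (\<lambda>z. mpoly_eval z G)" by blast
  then show ?case by (intro exI[of _ "F + G"]) (simp add: mpoly_eval_add)
next
  case (var_mult v f)
  then obtain F where F: "f = (\<lambda>z. mpoly_eval z F)" by blast
  show ?case
    unfolding F
    \<comment> \<open>Multiplication by the coordinate \<open>v\<close> shifts every exponent vector
      by that of \<open>v\<close>.\<close>
    by (rule exI[of _ "\<Sum>m\<in>Poly_Mapping.keys F.
          Poly_Mapping.single (Poly_Mapping.single v 1 + m) (Poly_Mapping.lookup F m)"])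
      (simp add: fun_eq_iff mpoly_eval_eq[of _ F] mpoly_eval_sum mpoly_eval_single monom_eval_add
        sum_distrib_left, simp add: monom_eval_def mult.left_commute)
qed

lemma poly_fun_zero_on_nats_imp_zero:
  fixes f :: "('v \<Rightarrow> 'k::field_char_0) \<Rightarrow> 'k"
  assumes "poly_fun S f" "\<And>z. range z \<subseteq> \<nat> \<Longrightarrow> f z = 0"
  shows "f z = 0"
proof -
  obtain F where F: "f = (\<lambda>z. mpoly_eval z F)" using poly_fun_imp_mpoly[OF assms(1)] by blast
  then have "F = 0" using assms(2) by (intro mpoly_eq_0) auto
  then show ?thesis by (simp add: F mpoly_eval_zero)
qed

section \<open>Real points and real coefficients inside the complex setting\<close>

lemma Nats_imp_of_real:
  assumes "range (z :: 'v \<Rightarrow> 'k::real_algebra_1) \<subseteq> \<nat>"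
  shows "\<exists>r. z = (\<lambda>v. of_real (r v))"
proof -
  have "\<exists>r. z v = of_real r" for v
    using assms by (metis Nats_cases of_real_of_nat_eq rangeI subsetD)
  then show ?thesis by metis
qed

text \<open>Zariski density of the real points: natural coordinates are real, and vanishing on
  points with natural coordinates already forces a polynomial to be zero.\<close>

lemma poly_fun_zero_on_reals_imp_zero:
  fixes f :: "('v \<Rightarrow> complex) \<Rightarrow> complex"
  assumes "poly_fun S f" "\<And>r. f (\<lambda>v. of_real (r v)) = 0"
  shows "f z = 0"
proof (rule poly_fun_zero_on_nats_imp_zero[OF assms(1)])
  fix z :: "'v \<Rightarrow> complex" assume "range z \<subseteq> \<nat>"
  then obtain r where "z = (\<lambda>v. of_real (r v))" using Nats_imp_of_real by blast
  then show "f z = 0" using assms(2) by simp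
qed

definition mpoly_of_real :: "('v, real) mpoly \<Rightarrow> ('v, complex) mpoly" where
  "mpoly_of_real F = Poly_Mapping.map of_real F"

lemma mpoly_eval_of_real:
  "mpoly_eval (\<lambda>v. of_real (z v)) (mpoly_of_real F) = of_real (mpoly_eval z F)"
proof -
  have "mpoly_eval (\<lambda>v. of_real (z v)) (mpoly_of_real F) = (\<Sum>m\<in>Poly_Mapping.keys F.
     Poly_Mapping.lookup (mpoly_of_real F) m *
       (\<Prod>v\<in>Poly_Mapping.keys m. of_real (z v) ^ Poly_Mapping.lookup m v))"
    by (rule mpoly_eval_superset)
      (auto simp: mpoly_of_real_def in_keys_iff Poly_Mapping.map.rep_eq when_def)
  also have "\<dots> = of_real (mpoly_eval z F)"
    by (auto simp: mpoly_eval_def mpoly_of_real_def Poly_Mapping.map.rep_eq when_def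
        intro!: sum.cong)
  finally show ?thesis .
qed

text \<open>Monomials take real values at real points, so splitting each coefficient into real and
  imaginary part splits the value.\<close>

lemma mpoly_complex_split:
  fixes Q :: "('v, complex) mpoly"
  shows "\<exists>F G. \<forall>z. mpoly_eval (\<lambda>v. of_real (z v)) Q
    = of_real (mpoly_eval z F) + \<i> * of_real (mpoly_eval z G)"
proof -
  let ?F = "Poly_Mapping.map Re Q" and ?G = "Poly_Mapping.map Im Q"
  have K: "Poly_Mapping.keys ?F \<subseteq> Poly_Mapping.keys Q" "Poly_Mapping.keys ?G \<subseteq> Poly_Mapping.keys Q"
    by (auto simp: in_keys_iff Poly_Mapping.map.rep_eq when_def)
  have l: "Poly_Mapping.lookup ?F m = Re (Poly_Mapping.lookup Q m)"
    "Poly_Mapping.lookup ?G m = Im (Poly_Mapping.lookup Q m)" for m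
    by (auto simp: Poly_Mapping.map.rep_eq when_def)
  have q: "Poly_Mapping.lookup Q m * of_real X
      = of_real (Re (Poly_Mapping.lookup Q m) * X) + \<i> * of_real (Im (Poly_Mapping.lookup Q m) * X)"
    for m X
    by (simp add: complex_eq_iff)
  have "mpoly_eval (\<lambda>v. of_real (z v)) Q
      = of_real (mpoly_eval z ?F) + \<i> * of_real (mpoly_eval z ?G)" for z
    unfolding mpoly_eval_superset[OF finite_keys K(1)] mpoly_eval_superset[OF finite_keys K(2)] l
      mpoly_eval_def[of _ Q] of_real_sum of_real_power[symmetric] of_real_prod[symmetric] q
    by (simp only: sum.distrib sum_distrib_left)
  then show ?thesis by blast
qed

section \<open>Invariance over the complex numbers\<close>

text \<open>The row \<open>l\<close> times the adjugate of \<open>T\<close>. It is polynomial in all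
  entries, so in contrast to \<open>matrix_inv\<close> it is directly accessible to
  \<open>poly_fun\<close>.\<close>

definition adj_row :: "'k::comm_ring_1^3^3 \<Rightarrow> 'k^3 \<Rightarrow> 'k^3" where
  "adj_row T l = vector
    [l$1 * (T$2$2 * T$3$3 - T$2$3 * T$3$2) + l$2 * (T$2$3 * T$3$1 - T$2$1 * T$3$3)
       + l$3 * (T$2$1 * T$3$2 - T$2$2 * T$3$1),
     l$1 * (T$3$2 * T$1$3 - T$3$3 * T$1$2) + l$2 * (T$3$3 * T$1$1 - T$3$1 * T$1$3)
       + l$3 * (T$3$1 * T$1$2 - T$3$2 * T$1$1),
     l$1 * (T$1$2 * T$2$3 - T$1$3 * T$2$2) + l$2 * (T$1$3 * T$2$1 - T$1$1 * T$2$3)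
       + l$3 * (T$1$1 * T$2$2 - T$1$2 * T$2$1)]"

lemma adj_row_mult: "adj_row T l v* T = det T *s l"
  by (simp add: vec_eq_iff forall_3 vector_matrix_mult_def sum_3 adj_row_def det_3 algebra_simps)

lemma vector_matrix_inv_eq:
  fixes T :: "'k::field^3^3"
  assumes "det T \<noteq> 0"
  shows "l v* matrix_inv T = (1 / det T) *s adj_row T l"
proof -
  have T: "invertible T" using assms by (simp add: invertible_det_nz)
  have "l = (1 / det T) *s (adj_row T l v* T)"
    using assms by (simp add: adj_row_mult)
  also have "\<dots> = ((1 / det T) *s adj_row T l) v* T"
    by (simp add: vec_eq_iff forall_3 vector_matrix_mult_def sum_3 algebra_simps)
  finally have "l v* matrix_inv T = ((1 / det T) *s adj_row T l) v* (T ** matrix_inv T)"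
    by (metis vector_matrix_mul_assoc)
  then show ?thesis by (simp add: matrix_inv_both[OF T])
qed

text \<open>The projective action in closed form over an arbitrary field, so that it makes sense for
  real and for complex points.\<close>

definition field_s :: "'k::field^3^3 \<Rightarrow> ('n aff_var \<Rightarrow> 'k) \<Rightarrow> 'n \<Rightarrow> 'k" where
  "field_s T z i = T$3$1 * z (Vx i) + T$3$2 * z (Vy i) + T$3$3"

definition field_l :: "('n aff_var \<Rightarrow> 'k::field) \<Rightarrow> 'n \<Rightarrow> 'k^3" where
  "field_l z i = vector [z (Vp i), z (Vq i), - z (Vp i) * z (Vx i) - z (Vq i) * z (Vy i)]"

primrec field_act :: "'k::field^3^3 \<Rightarrow> ('n aff_var \<Rightarrow> 'k) \<Rightarrow> 'n aff_var \<Rightarrow> 'k" where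
  "field_act T z (Vx i) = (T$1$1 * z (Vx i) + T$1$2 * z (Vy i) + T$1$3) / field_s T z i"
| "field_act T z (Vy i) = (T$2$1 * z (Vx i) + T$2$2 * z (Vy i) + T$2$3) / field_s T z i"
| "field_act T z (Vp i) = field_s T z i * adj_row T (field_l z i) $ 1 / det T"
| "field_act T z (Vq i) = field_s T z i * adj_row T (field_l z i) $ 2 / det T"

lemma aff_s_eq_field_s: "aff_s T z i = field_s T z i"
  by (simp add: aff_s_def field_s_def)

lemma aff_act_eq_field_act:
  assumes "det T \<noteq> 0"
  shows "aff_act T z = field_act T z"
proof
  fix v
  have "aff_l z i = field_l z i" for i by (simp add: aff_l_def field_l_def)
  then show "aff_act T z v = field_act T z v"
    by (cases v) (simp_all add: vector_matrix_inv_eq[OF assms] aff_s_eq_field_s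
        matrix_vector_mult_def sum_3 aff_A_def)
qed

definition mat_of_real :: "real^3^3 \<Rightarrow> complex^3^3" where
  "mat_of_real T = (\<chi> i j. of_real (T$i$j))"

lemma mat_of_real_nth [simp]: "mat_of_real T $ i $ j = of_real (T$i$j)"
  by (simp add: mat_of_real_def)

lemma det_mat_of_real: "det (mat_of_real T) = of_real (det T)"
  by (simp add: det_3)

lemma field_s_of_real: "field_s (mat_of_real T) (\<lambda>v. of_real (z v)) i = of_real (field_s T z i)"
  by (simp add: field_s_def)

lemma field_act_of_real:
  "field_act (mat_of_real T) (\<lambda>v. of_real (z v)) = (\<lambda>v. of_real (field_act T z v))"
proof
  fix v
  show "field_act (mat_of_real T) (\<lambda>v. of_real (z v)) v = of_real (field_act T z v)"
    by (cases v) (simp_all add: field_s_of_real det_mat_of_real adj_row_def field_l_def)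
qed

text \<open>The weight condition with its denominators cleared, the form in which it is transferred
  to complex matrices and points.\<close>

lemma proj_invariantsD:
  fixes F :: "('n::finite aff_var, real) mpoly"
  assumes "F \<in> proj_invariants" "det T \<noteq> 0" "\<And>i. field_s T z i \<noteq> 0"
  shows "det T ^ CARD('n) * mpoly_eval (field_act T z) F = (\<Prod>i\<in>UNIV. field_s T z i ^ 3) * mpoly_eval z F"
proof -
  have "mpoly_eval (aff_act T z) F = inverse (aff_J T z) * mpoly_eval z F"
    using assms by (auto simp: proj_invariants_def invertible_det_nz aff_s_eq_field_s)
  then show ?thesis
    using assms(2) by (simp add: aff_act_eq_field_act aff_J_def aff_s_eq_field_s field_simps)
qed

text \<open>After clearing denominators the claim is one polynomial identity in the entries of
  \<open>T\<close> and the coordinates of \<open>z\<close> together. It holds at real values, hence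
  at complex ones.\<close>

lemma proj_invariants_complex:
  fixes F :: "('n::finite aff_var, real) mpoly"
  assumes F: "F \<in> proj_invariants" and T: "det T \<noteq> 0" and s: "\<And>i. field_s T z i \<noteq> 0"
  defines "f \<equiv> \<lambda>z. mpoly_eval z (mpoly_of_real F)"
  shows "det T ^ CARD('n) * f (field_act T z) = (\<Prod>i\<in>UNIV. field_s T z i ^ 3) * f z"
proof -
  define cT :: "((3 \<times> 3) + 'n aff_var \<Rightarrow> complex) \<Rightarrow> complex^3^3"
    where "cT = (\<lambda>u. \<chi> i j. u (Inl (i, j)))"
  define cz :: "((3 \<times> 3) + 'n aff_var \<Rightarrow> complex) \<Rightarrow> 'n aff_var \<Rightarrow> complex"
    where "cz = (\<lambda>u v. u (Inr v))"
  \<comment> \<open>A common denominator for the whole action: the \<open>x\<close> and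
    \<open>y\<close> components contribute the factors \<open>s_i\<close>, the \<open>p\<close> and
    \<open>q\<close> components the determinant.\<close>
  define d where "d = (\<lambda>u. det (cT u) * (\<Prod>i\<in>UNIV. field_s (cT u) (cz u) i))"
  have cT: "poly_fun UNIV (\<lambda>u. cT u $ i $ j)" for i j
    unfolding cT_def by (simp add: poly_fun_var)
  have cz: "poly_fun UNIV (\<lambda>u. cz u v)" for v
    unfolding cz_def by (simp add: poly_fun_var)
  have det: "poly_fun UNIV (\<lambda>u. det (cT u))"
    unfolding det_3 by (intro poly_fun_intros cT)
  have fs: "poly_fun UNIV (\<lambda>u. field_s (cT u) (cz u) i)" for i
    unfolding field_s_def by (intro poly_fun_intros cT cz)
  have fl: "poly_fun UNIV (\<lambda>u. field_l (cz u) i $ j)" for i j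
  proof -
    have "\<forall>j. poly_fun UNIV (\<lambda>u. field_l (cz u) i $ j)"
      unfolding forall_3 field_l_def vector_3 by (intro conjI poly_fun_intros cz)
    then show ?thesis by blast
  qed
  have adj: "poly_fun UNIV (\<lambda>u. adj_row (cT u) (field_l (cz u) i) $ j)" for i j
  proof -
    have "\<forall>j. poly_fun UNIV (\<lambda>u. adj_row (cT u) (field_l (cz u) i) $ j)"
      unfolding forall_3 adj_row_def vector_3 by (intro conjI poly_fun_intros cT fl)
    then show ?thesis by blast
  qed
  have d: "poly_fun UNIV d"
    unfolding d_def by (intro poly_fun_intros det fs)
  have f: "poly_fun UNIV f"
    unfolding f_def by (rule poly_fun_mpoly_eval)
  have "\<exists>g. poly_fun UNIV g \<and> (\<forall>u\<in>{u. d u \<noteq> 0}. field_act (cT u) (cz u) v = g u / d u)" for v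
  proof -
    have s: "(\<Prod>j\<in>UNIV. field_s (cT u) (cz u) j)
        = field_s (cT u) (cz u) i * (\<Prod>j\<in>UNIV - {i}. field_s (cT u) (cz u) j)" for u i
      by (rule prod.remove) auto
    have ps: "poly_fun UNIV (\<lambda>u. det (cT u) * (\<Prod>j\<in>UNIV - {i}. field_s (cT u) (cz u) j))" for i
      by (intro poly_fun_intros det fs)
    have xy: ?thesis if "\<And>u. field_act (cT u) (cz u) v = h u / field_s (cT u) (cz u) i"
      "poly_fun UNIV h" for h i
    proof (intro exI[of _ "\<lambda>u. h u * (det (cT u) * (\<Prod>j\<in>UNIV - {i}. field_s (cT u) (cz u) j))"]
        conjI ballI)
      show "poly_fun UNIV (\<lambda>u. h u * (det (cT u) * (\<Prod>j\<in>UNIV - {i}. field_s (cT u) (cz u) j)))"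
        by (intro poly_fun_mult that ps)
    next
      fix u assume "u \<in> {u. d u \<noteq> 0}"
      then show "field_act (cT u) (cz u) v
          = h u * (det (cT u) * (\<Prod>j\<in>UNIV - {i}. field_s (cT u) (cz u) j)) / d u"
        unfolding that(1) d_def s[of u i] by simp
    qed
    have pq: ?thesis if "\<And>u. field_act (cT u) (cz u) v = h u / det (cT u)"
      "poly_fun UNIV h" for h
    proof (intro exI[of _ "\<lambda>u. h u * (\<Prod>j\<in>UNIV. field_s (cT u) (cz u) j)"] conjI ballI)
      show "poly_fun UNIV (\<lambda>u. h u * (\<Prod>j\<in>UNIV. field_s (cT u) (cz u) j))"
        by (intro poly_fun_intros that fs)
    next
      fix u assume "u \<in> {u. d u \<noteq> 0}"
      then show "field_act (cT u) (cz u) v = h u * (\<Prod>j\<in>UNIV. field_s (cT u) (cz u) j) / d u"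
        unfolding that(1) d_def by simp
    qed
    show ?thesis
    proof (cases v)
      case (Vx i)
      show ?thesis unfolding Vx
        by (rule xy[unfolded Vx, OF field_act.simps(1)]) (intro poly_fun_intros cT cz)
    next
      case (Vy i)
      show ?thesis unfolding Vy
        by (rule xy[unfolded Vy, OF field_act.simps(2)]) (intro poly_fun_intros cT cz)
    next
      case (Vp i)
      show ?thesis unfolding Vp
        by (rule pq[unfolded Vp, OF field_act.simps(3)]) (intro poly_fun_intros fs adj)
    next
      case (Vq i)
      show ?thesis unfolding Vq
        by (rule pq[unfolded Vq, OF field_act.simps(4)]) (intro poly_fun_intros fs adj)
    qed
  qed
  then have "\<exists>N g. poly_fun UNIV g \<and> (\<forall>u\<in>{u. d u \<noteq> 0}.
      f (\<lambda>v. field_act (cT u) (cz u) v) = g u / d u ^ N)"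
    by (rule poly_fun_clear_denominators[OF f d]) simp_all
  then obtain N g where g: "poly_fun UNIV g"
    "\<And>u. d u \<noteq> 0 \<Longrightarrow> f (field_act (cT u) (cz u)) = g u / d u ^ N"
    by blast
  \<comment> \<open>The leading factor \<open>d u\<close> makes \<open>h\<close> vanish where the
    action is undefined, so that \<open>h\<close> is zero at every real point without
    exception.\<close>
  define h where "h = (\<lambda>u. d u * (det (cT u) ^ CARD('n) * g u
      - d u ^ N * ((\<Prod>i\<in>UNIV. field_s (cT u) (cz u) i ^ 3) * f (cz u))))"
  have h: "h u = d u ^ Suc N * (det (cT u) ^ CARD('n) * f (field_act (cT u) (cz u))
      - (\<Prod>i\<in>UNIV. field_s (cT u) (cz u) i ^ 3) * f (cz u))" for u
    by (cases "d u = 0") (simp_all add: h_def g(2) field_simps)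
  have fcz: "poly_fun UNIV (\<lambda>u. f (cz u))"
    using poly_fun_compose[OF f, of UNIV "\<lambda>v u. cz u v"] cz by simp
  have hp: "poly_fun UNIV h"
    unfolding h_def by (intro poly_fun_intros d det g(1) fs fcz)
  have "h (\<lambda>v. of_real (r v)) = 0" for r
  proof (cases "d (\<lambda>v. of_real (r v)) = 0")
    case False
    define T :: "real^3^3" where "T = (\<chi> i j. r (Inl (i, j)))"
    define z where "z = (\<lambda>v. r (Inr v))"
    have T: "cT (\<lambda>v. of_real (r v)) = mat_of_real T"
      by (simp add: cT_def T_def vec_eq_iff)
    have z: "cz (\<lambda>v. of_real (r v)) = (\<lambda>v. of_real (z v))"
      by (simp add: cz_def z_def)
    have "det T ^ CARD('n) * mpoly_eval (field_act T z) F
        = (\<Prod>i\<in>UNIV. field_s T z i ^ 3) * mpoly_eval z F"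
      using False by (intro proj_invariantsD F) (auto simp: d_def T z det_mat_of_real field_s_of_real)
    then have "complex_of_real (det T ^ CARD('n) * mpoly_eval (field_act T z) F)
        = of_real ((\<Prod>i\<in>UNIV. field_s T z i ^ 3) * mpoly_eval z F)" by simp
    then show ?thesis
      unfolding h T z
      by (simp add: f_def det_mat_of_real field_s_of_real field_act_of_real mpoly_eval_of_real)
  qed (simp add: h)
  then have "h u = 0" for u by (rule poly_fun_zero_on_reals_imp_zero[OF hp])
  from this[of "case_sum (\<lambda>(i, j). T$i$j) z"] T s show ?thesis
    unfolding h by (simp add: d_def cT_def cz_def)
qed

section \<open>Homogenization of affine invariants\<close>

definition hom_U :: "'n hom_point set" where
  "hom_U = {z \<in> hom_M. \<forall>i. fst (z i) $ 3 \<noteq> 0}"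

primrec aff_of :: "'n hom_point \<Rightarrow> 'n aff_var \<Rightarrow> complex" where
  "aff_of z (Vx i) = fst (z i) $ 1 / fst (z i) $ 3"
| "aff_of z (Vy i) = fst (z i) $ 2 / fst (z i) $ 3"
| "aff_of z (Vp i) = fst (z i) $ 3 * snd (z i) $ 1"
| "aff_of z (Vq i) = fst (z i) $ 3 * snd (z i) $ 2"

text \<open>The functions \<open>aff_of\<close> are constant on torus orbits in
  \<open>hom_U\<close>, so the weight -3 in each \<open>t_i\<close> comes entirely from the
  denominator.\<close>

definition homogenize :: "(('n::finite aff_var \<Rightarrow> complex) \<Rightarrow> complex) \<Rightarrow> 'n hom_point \<Rightarrow> complex" where
  "homogenize f z = f (aff_of z) / (\<Prod>i\<in>UNIV. fst (z i) $ 3 ^ 3)"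

lemma SL_act_eq: "det G = 1 \<Longrightarrow> SL_act G z = (\<lambda>i. (G *v fst (z i), adj_row G (snd (z i))))"
  by (simp add: SL_act_def vector_matrix_inv_eq)

lemma hom_M_iff: "z \<in> hom_M \<longleftrightarrow> (\<forall>i. snd (z i) $ 1 * fst (z i) $ 1 + snd (z i) $ 2 * fst (z i) $ 2
    + snd (z i) $ 3 * fst (z i) $ 3 = 0)"
  by (simp add: hom_M_def sum_3)

lemma adj_row_pairing:
  "(\<Sum>j\<in>UNIV. adj_row G l $ j * (G *v a) $ j) = det G * (\<Sum>j\<in>UNIV. l $ j * a $ j)"
  by (simp add: adj_row_def matrix_vector_mult_def sum_3 det_3 algebra_simps)

lemma SL_act_hom_M: "det G = 1 \<Longrightarrow> z \<in> hom_M \<Longrightarrow> SL_act G z \<in> hom_M"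
  by (simp add: hom_M_def SL_act_eq adj_row_pairing)

lemma SL_act_mult:
  assumes "det G = 1" "det H = 1"
  shows "SL_act G (SL_act H z) = SL_act (G ** H) z"
proof -
  have "adj_row G (adj_row H l) = adj_row (G ** H) l" for l :: "complex^3"
    by (simp add: vec_eq_iff forall_3 adj_row_def matrix_matrix_mult_def sum_3 algebra_simps)
  then show ?thesis
    using assms by (simp add: SL_act_eq det_mul matrix_vector_mul_assoc)
qed

text \<open>In affine coordinates \<open>G\<close> acts by \<open>field_act\<close>. As
  \<open>det G = 1\<close>, the weight factor is the product of the \<open>s_i^3\<close>, where
  \<open>s_i\<close> is the quotient of the new \<open>w_i\<close> by the old one; this is exactly
  how the denominator of \<open>homogenize\<close> changes.\<close>

lemma homogenize_SL_act:
  fixes F :: "('n::finite aff_var, real) mpoly"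
  assumes F: "F \<in> proj_invariants" and G: "det G = 1"
    and z: "z \<in> hom_U" and Gz: "SL_act G z \<in> hom_U"
  defines "f \<equiv> \<lambda>z. mpoly_eval z (mpoly_of_real F)"
  shows "homogenize f (SL_act G z) = homogenize f z"
proof -
  have w: "fst (z i) $ 3 \<noteq> 0" for i using z by (simp add: hom_U_def)
  have w': "(G *v fst (z i)) $ 3 \<noteq> 0" for i using Gz by (simp add: hom_U_def SL_act_def)
  have s: "field_s G (aff_of z) i = (G *v fst (z i)) $ 3 / fst (z i) $ 3" for i
    using w[of i] by (simp add: field_s_def matrix_vector_mult_def sum_3 field_simps)
  \<comment> \<open>On \<open>hom_U\<close> the relation \<open>ell_i A_i = 0\<close> determines the
    third covector coordinate, which is how \<open>field_l\<close> reconstructs it.\<close>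
  have l: "field_l (aff_of z) i = fst (z i) $ 3 *s snd (z i)" for i
  proof -
    have "snd (z i) $ 1 * fst (z i) $ 1 + snd (z i) $ 2 * fst (z i) $ 2
      + snd (z i) $ 3 * fst (z i) $ 3 = 0"
      using z by (simp add: hom_U_def hom_M_iff)
    then have "snd (z i) $ 3 * fst (z i) $ 3
        = - (snd (z i) $ 1 * fst (z i) $ 1) - snd (z i) $ 2 * fst (z i) $ 2" by algebra
    then show ?thesis
      using w[of i] by (simp add: vec_eq_iff forall_3 field_l_def mult.commute)
  qed
  have adj: "adj_row G (c *s a) $ j = c * adj_row G a $ j" for c a j
  proof -
    have "adj_row G (c *s a) = c *s adj_row G a"
      by (simp add: vec_eq_iff forall_3 adj_row_def algebra_simps)
    then show ?thesis by simp
  qed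
  have "aff_of (SL_act G z) = field_act G (aff_of z)"
  proof
    fix v
    show "aff_of (SL_act G z) v = field_act G (aff_of z) v"
      using w w'
      by (cases v) (simp_all add: SL_act_eq[OF G] G s l adj, simp_all add:
          matrix_vector_mult_def sum_3 field_simps)
  qed
  moreover have "f (field_act G (aff_of z)) = (\<Prod>i\<in>UNIV. field_s G (aff_of z) i ^ 3) * f (aff_of z)"
    using proj_invariants_complex[OF F, of G "aff_of z"] G w w' by (simp add: f_def s)
  ultimately show ?thesis
    using w w' by (simp add: homogenize_def s SL_act_def power_divide prod_dividef)
qed

text \<open>Invariance under \<open>G' G^(-1)\<close>, applied at \<open>SL_act G z\<close>. The
  point \<open>z\<close> itself may lie outside \<open>hom_U\<close>, as it does on the hypersurface
  \<open>w_i = 0\<close>.\<close>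

lemma homogenize_SL_act_eq:
  fixes F :: "('n::finite aff_var, real) mpoly"
  assumes F: "F \<in> proj_invariants" and G: "det G = 1" "det G' = 1"
    and z: "SL_act G z \<in> hom_U" and z': "SL_act G' z \<in> hom_U"
  defines "f \<equiv> \<lambda>z. mpoly_eval z (mpoly_of_real F)"
  shows "homogenize f (SL_act G' z) = homogenize f (SL_act G z)"
proof -
  have inv: "invertible G" using G by (simp add: invertible_det_nz)
  define K where "K = G' ** matrix_inv G"
  have "det (matrix_inv G) * det G = 1"
    using matrix_inv_both(2)[OF inv] by (metis det_mul det_I)
  then have "det K = 1" using G by (simp add: K_def det_mul)
  moreover have "K ** G = G'"
    by (simp add: K_def matrix_mul_assoc[symmetric] matrix_inv_both[OF inv])
  ultimately have "SL_act G' z = SL_act K (SL_act G z)" "det K = 1"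
    using G by (auto simp: SL_act_mult)
  then show ?thesis
    using homogenize_SL_act[OF F, of K "SL_act G z"] z z' by (simp add: f_def)
qed

section \<open>Removing the poles\<close>

lemma eventually_poly_neq_0:
  fixes p :: "'k::real_normed_field poly"
  assumes "p \<noteq> 0"
  shows "\<forall>\<^sub>F t in at a. poly p t \<noteq> 0"
proof -
  have "finite ({t. poly p t = 0} - {a})" using assms by (simp add: poly_roots_finite)
  then have "open (- ({t. poly p t = 0} - {a}))"
    unfolding open_closed by (simp only: double_complement finite_imp_closed)
  then have "\<forall>\<^sub>F t in at a. t \<in> - ({t. poly p t = 0} - {a}) - {a}"
    by (rule eventually_at_in_open) simp
  then show ?thesis by (rule eventually_mono) auto
qed

text \<open>A nonconstant polynomial is eventually large in absolute value, and a constant equals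
  its limit.\<close>

lemma poly_eq_0_if_tendsto_0_at_infinity:
  fixes g :: "complex poly"
  assumes "(poly g \<longlongrightarrow> 0) at_infinity"
  shows "g = 0"
proof (cases g)
  case (pCons a p)
  have nontrivial: "\<not> trivial_limit (at_infinity :: complex filter)"
    by (rule trivial_limit_at_infinity)
  show ?thesis
  proof (cases "p = 0")
    case True
    then have "poly g = (\<lambda>_. a)" using pCons by auto
    then have "a = 0" using assms nontrivial by (simp add: tendsto_const_iff)
    then show ?thesis using True pCons by simp
  next
    case False
    from poly_infinity[OF False, of 1 a] obtain r where r: "\<And>z. r \<le> norm z \<Longrightarrow> 1 \<le> norm (poly g z)"
      using pCons by auto
    have "\<forall>\<^sub>F z in at_infinity. r \<le> norm (z :: complex)"
      unfolding eventually_at_infinity by auto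
    moreover have "\<forall>\<^sub>F z in at_infinity. norm (poly g z) < 1"
      using tendstoD[OF assms, of 1] by (simp add: dist_norm)
    ultimately have "\<forall>\<^sub>F z in (at_infinity :: complex filter). False"
      by eventually_elim (use r in force)
    then show ?thesis using nontrivial by (simp add: eventually_False)
  qed
qed

text \<open>The first summand has only nonnegative powers of \<open>x\<close> and the second only
  negative ones, so they cannot cancel. Analytically, the second summand tends to 0 at infinity,
  hence so does \<open>g\<close>.\<close>

lemma poly_eq_0_if_eq_reciprocal_poly:
  fixes g h :: "complex poly"
  assumes "\<And>x. x \<noteq> 0 \<Longrightarrow> poly g x + (\<kappa> / x) * poly h (\<kappa> / x) = 0"
  shows "g = 0"
proof (rule poly_eq_0_if_tendsto_0_at_infinity)
  have \<kappa>: "((\<lambda>x. \<kappa> / x) \<longlongrightarrow> 0) at_infinity"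
    by (intro tendsto_divide_0[OF tendsto_const] filterlim_ident)
  then have "((\<lambda>x. poly h (\<kappa> / x)) \<longlongrightarrow> poly h 0) at_infinity" by (rule tendsto_poly)
  from tendsto_minus[OF tendsto_mult[OF \<kappa> this]]
  have "((\<lambda>x. - ((\<kappa> / x) * poly h (\<kappa> / x))) \<longlongrightarrow> 0) at_infinity" by simp
  moreover have "\<forall>\<^sub>F x in at_infinity. - ((\<kappa> / x) * poly h (\<kappa> / x)) = poly g x"
    using eventually_not_equal_at_infinity[of 0]
    by eventually_elim (rule assms[THEN add_eq_0_iff2[THEN iffD1], symmetric])
  ultimately show "(poly g \<longlongrightarrow> 0) at_infinity"
    by (rule Lim_transform_eventually)
qed

section \<open>Divisibility by \<open>w_i\<close> on the variety \<open>hom_M\<close>\<close>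

abbreviation pairing_coord :: "('n hom_var \<Rightarrow> complex) \<Rightarrow> 'n \<Rightarrow> complex" where
  "pairing_coord c i \<equiv> c (Vl i 1) * c (VA i 1) + c (Vl i 2) * c (VA i 2) + c (Vl i 3) * c (VA i 3)"

text \<open>Modulo \<open>w\<^sub>i\<close>, the relation \<open>\<ell>\<^sub>iA\<^sub>i = 0\<close> rewrites \<open>p\<^sub>ix\<^sub>i\<close> to \<open>-q\<^sub>iy\<^sub>i\<close>, so that
  no monomial needs to contain both \<open>p\<^sub>i\<close> and \<open>x\<^sub>i\<close>.\<close>

lemma poly_fun_normal_form:
  fixes f :: "('n hom_var \<Rightarrow> complex) \<Rightarrow> complex" and i :: 'n
  assumes "poly_fun UNIV f"
  shows "\<exists>U V g. poly_fun (UNIV - {VA i 3, Vl i 1}) U \<and> poly_fun (UNIV - {VA i 3, VA i 1}) V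
    \<and> poly_fun UNIV g
    \<and> (\<forall>c. pairing_coord c i = 0 \<longrightarrow> f c = U c + c (Vl i 1) * V c + c (VA i 3) * g c)"
  using assms
proof (induction rule: poly_fun.induct)
  case (const a)
  show ?case
    by (intro exI[of _ "\<lambda>_. a"] exI[of _ "\<lambda>_. 0"] conjI poly_fun.const) simp
next
  case (add f f')
  then obtain U V g U' V' g' where
    "poly_fun (UNIV - {VA i 3, Vl i 1}) U" "poly_fun (UNIV - {VA i 3, VA i 1}) V" "poly_fun UNIV g"
    "\<forall>c. pairing_coord c i = 0 \<longrightarrow> f c = U c + c (Vl i 1) * V c + c (VA i 3) * g c"
    "poly_fun (UNIV - {VA i 3, Vl i 1}) U'" "poly_fun (UNIV - {VA i 3, VA i 1}) V'" "poly_fun UNIV g'"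
    "\<forall>c. pairing_coord c i = 0 \<longrightarrow> f' c = U' c + c (Vl i 1) * V' c + c (VA i 3) * g' c"
    by blast
  then show ?case
    by (intro exI[of _ "\<lambda>c. U c + U' c"] exI[of _ "\<lambda>c. V c + V' c"] exI[of _ "\<lambda>c. g c + g' c"])
      (simp add: poly_fun.add algebra_simps)
next
  case (var_mult v f)
  let ?S = "UNIV - {VA i 3, Vl i 1}" and ?S' = "UNIV - {VA i 3, VA i 1}"
  obtain U V g where U: "poly_fun ?S U" and V: "poly_fun ?S' V" and g: "poly_fun UNIV g" and
    f: "\<And>c. pairing_coord c i = 0 \<Longrightarrow> f c = U c + c (Vl i 1) * V c + c (VA i 3) * g c"
    using var_mult.IH by blast
  note V_mono = poly_fun_mono[OF V, of UNIV, simplified]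
  consider "v = VA i 3" | "v = VA i 1" | "v = Vl i 1" | "v \<in> ?S \<inter> ?S'" by blast
  then show ?case
  proof cases
    case 1
    show ?thesis
      by (intro exI[of _ "\<lambda>_. 0"] exI[of _ f] conjI poly_fun.const var_mult) (simp add: 1)
  next
    case 2
    \<comment> \<open>The new factor \<open>x\<close> meets the factor \<open>p\<close> in front of
      \<open>V\<close>. Rewriting \<open>p x\<close> as \<open>- q y - r w\<close> leaves multiples
      of \<open>V\<close>: its part \<open>V0\<close> without \<open>p\<close> joins
      \<open>U\<close>, the part \<open>p V1\<close> stays with \<open>V\<close>, and the multiple
      of \<open>w\<close> goes to \<open>g\<close>.\<close>
    obtain V0 V1 where V01: "poly_fun (?S' - {Vl i 1}) V0" "poly_fun ?S' V1"
      "\<And>c. V c = V0 c + c (Vl i 1) * V1 c"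
      using poly_fun_split_var[OF V, of "Vl i 1"] by blast
    have V0: "poly_fun ?S V0" by (rule poly_fun_mono[OF V01(1)]) auto
    have "poly_fun ?S (\<lambda>c. c (VA i 1) * U c - c (Vl i 2) * c (VA i 2) * V0 c)"
      "poly_fun ?S' (\<lambda>c. - (c (Vl i 2) * c (VA i 2) * V1 c))"
      "poly_fun UNIV (\<lambda>c. c (VA i 1) * g c - c (Vl i 3) * V c)"
      by (intro poly_fun_intros U V0 V01 g V_mono; simp)+
    moreover have "c v * f c = c (VA i 1) * U c - c (Vl i 2) * c (VA i 2) * V0 c
        + c (Vl i 1) * - (c (Vl i 2) * c (VA i 2) * V1 c)
        + c (VA i 3) * (c (VA i 1) * g c - c (Vl i 3) * V c)" if "pairing_coord c i = 0" for c
    proof -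
      have "c v * f c = c (VA i 1) * U c + c (Vl i 1) * c (VA i 1) * V c + c (VA i 3) * (c (VA i 1) * g c)"
        by (simp add: 2 f[OF that] algebra_simps)
      also have "c (Vl i 1) * c (VA i 1) = - (c (Vl i 2) * c (VA i 2)) - c (Vl i 3) * c (VA i 3)"
        using that by algebra
      finally show ?thesis using V01(3)[of c] by algebra
    qed
    ultimately show ?thesis by blast
  next
    case 3
    \<comment> \<open>The same rewriting with \<open>x\<close> and \<open>p\<close> exchanged: now
      \<open>U\<close> is split, and its part \<open>U0\<close> without \<open>x\<close> moves over
      to \<open>V\<close>.\<close>
    obtain U0 U1 where U01: "poly_fun (?S - {VA i 1}) U0" "poly_fun ?S U1"
      "\<And>c. U c = U0 c + c (VA i 1) * U1 c"
      using poly_fun_split_var[OF U, of "VA i 1"] by blast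
    have U0: "poly_fun ?S' U0" by (rule poly_fun_mono[OF U01(1)]) auto
    have "poly_fun ?S (\<lambda>c. - (c (Vl i 2) * c (VA i 2) * U1 c))"
      "poly_fun ?S' (\<lambda>c. U0 c + c (Vl i 1) * V c)"
      "poly_fun UNIV (\<lambda>c. c (Vl i 1) * g c - c (Vl i 3) * U1 c)"
      by (intro poly_fun_intros V U0 U01 g poly_fun_mono[OF U01(2)]; simp)+
    moreover have "c v * f c = - (c (Vl i 2) * c (VA i 2) * U1 c)
        + c (Vl i 1) * (U0 c + c (Vl i 1) * V c)
        + c (VA i 3) * (c (Vl i 1) * g c - c (Vl i 3) * U1 c)" if "pairing_coord c i = 0" for c
    proof -
      have "c v * f c = c (Vl i 1) * U0 c + c (Vl i 1) * c (VA i 1) * U1 c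
          + c (Vl i 1) * (c (Vl i 1) * V c) + c (VA i 3) * (c (Vl i 1) * g c)"
        by (simp add: 3 f[OF that] U01(3) algebra_simps)
      also have "c (Vl i 1) * c (VA i 1) = - (c (Vl i 2) * c (VA i 2)) - c (Vl i 3) * c (VA i 3)"
        using that by algebra
      finally show ?thesis by (simp add: algebra_simps)
    qed
    ultimately show ?thesis by blast
  next
    case 4
    have "poly_fun ?S (\<lambda>c. c v * U c)" "poly_fun ?S' (\<lambda>c. c v * V c)" "poly_fun UNIV (\<lambda>c. c v * g c)"
      using 4 by (auto intro: poly_fun.var_mult U V g)
    moreover have "c v * f c = c v * U c + c (Vl i 1) * (c v * V c) + c (VA i 3) * (c v * g c)"
      if "pairing_coord c i = 0" for c
      by (simp add: f[OF that] algebra_simps)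
    ultimately show ?thesis by blast
  qed
qed

text \<open>A vanishing \<open>A_i\<close> stays zero under every linear map, so these are the only
  points of \<open>hom_M\<close> that \<open>SL(3)\<close> can move into
  \<open>hom_U\<close>.\<close>

definition hom_reg :: "'n hom_point set" where
  "hom_reg = {z \<in> hom_M. \<forall>i. fst (z i) \<noteq> 0}"

definition point_of :: "('n hom_var \<Rightarrow> complex) \<Rightarrow> 'n hom_point" where
  "point_of c = (\<lambda>i. (\<chi> j. c (VA i j), \<chi> j. c (Vl i j)))"

lemma hom_coord_point_of [simp]: "hom_coord (point_of c) = c"
proof
  fix v show "hom_coord (point_of c) v = c v" by (cases v) (simp_all add: point_of_def)
qed

lemma point_of_hom_coord [simp]: "point_of (hom_coord z) = z"
  by (simp add: point_of_def fun_eq_iff prod_eq_iff vec_eq_iff)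

lemma hom_M_coord: "z \<in> hom_M \<longleftrightarrow> (\<forall>i. pairing_coord (hom_coord z) i = 0)"
  by (simp add: hom_M_iff)

text \<open>On \<open>w_i = 0\<close> with \<open>x_i = x\<close> nonzero the relation forces
  \<open>p_i = \<kappa> / x\<close>, where \<open>\<kappa> = - q_i y_i\<close>. In the normal form,
  vanishing of \<open>P\<close> then says that \<open>U\<close> at \<open>x\<close> plus
  \<open>\<kappa> / x\<close> times \<open>V\<close> at \<open>\<kappa> / x\<close> is zero for all
  such \<open>x\<close>. Comparing powers of \<open>x\<close> gives \<open>U = 0\<close>, then
  \<open>V = 0\<close>, and only \<open>w_i g\<close> remains.\<close>

lemma poly_fun_divide_w:
  fixes i :: "'n::finite"
  assumes P: "poly_fun UNIV P"
    and zero: "\<And>z. z \<in> hom_reg \<Longrightarrow> fst (z i) $ 3 = 0 \<Longrightarrow> P (hom_coord z) = 0"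
  shows "\<exists>g. poly_fun UNIV g \<and> (\<forall>z\<in>hom_U. P (hom_coord z) = fst (z i) $ 3 * g (hom_coord z))"
proof -
  obtain U V g where U: "poly_fun (UNIV - {VA i 3, Vl i 1}) U"
    and V: "poly_fun (UNIV - {VA i 3, VA i 1}) V" and g: "poly_fun UNIV g"
    and P_eq: "\<And>c. pairing_coord c i = 0 \<Longrightarrow> P c = U c + c (Vl i 1) * V c + c (VA i 3) * g c"
    using poly_fun_normal_form[OF P, of i] by blast
  \<comment> \<open>No condition is placed on the coordinates of the point \<open>i\<close>. For the
    other points, \<open>w_j \<noteq> 0\<close> ensures \<open>A_j \<noteq> 0\<close>, as
    \<open>hom_reg\<close> demands.\<close>
  define good where "good c \<longleftrightarrow> (\<forall>j. j \<noteq> i \<longrightarrow> pairing_coord c j = 0 \<and> c (VA j 3) \<noteq> 0)" for c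
  have on_hypersurface:
    "U (c(VA i 1 := x)) + (\<kappa> / x) * V (c(Vl i 1 := \<kappa> / x)) = 0"
    if c: "good c" and \<kappa>: "\<kappa> = - (c (Vl i 2) * c (VA i 2))" and x: "x \<noteq> 0" for c \<kappa> x
  proof -
    \<comment> \<open>The point of the hypersurface over \<open>c\<close> with first coordinate
      \<open>x\<close>. Neither \<open>U\<close> nor \<open>V\<close> involves \<open>w_i\<close>,
      and each omits one of \<open>x_i\<close>, \<open>p_i\<close>, so both can be read off from
      \<open>c\<close> with a single coordinate changed.\<close>
    define c' where "c' = c(VA i 1 := x, VA i 3 := 0, Vl i 1 := \<kappa> / x)"
    have rel: "pairing_coord c' j = 0" for j
      using c x by (cases "j = i") (auto simp: c'_def \<kappa> good_def)
    have "point_of c' \<in> hom_reg"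
      unfolding hom_reg_def
    proof (intro CollectI conjI allI)
      show "point_of c' \<in> hom_M" using rel by (simp add: hom_M_coord)
      fix j
      have "c' (VA j 1) \<noteq> 0 \<or> c' (VA j 3) \<noteq> 0"
        using c x by (cases "j = i") (auto simp: c'_def good_def)
      then show "fst (point_of c' j) \<noteq> 0" by (auto simp: point_of_def vec_eq_iff)
    qed
    then have "P c' = 0"
      using zero[of "point_of c'"] by (simp only: hom_coord_point_of) (simp add: point_of_def c'_def)
    moreover have "U c' = U (c(VA i 1 := x))"
      by (rule poly_fun_cong_on[OF U]) (auto simp: c'_def)
    moreover have "V c' = V (c(Vl i 1 := \<kappa> / x))"
      by (rule poly_fun_cong_on[OF V]) (auto simp: c'_def)
    moreover have c'_simps: "c' (VA i 3) = 0" "c' (Vl i 1) = \<kappa> / x" by (simp_all add: c'_def)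
    ultimately show ?thesis
      using P_eq[OF rel] c'_simps by simp
  qed
  have U0: "U c = 0" if c: "good c" for c
  proof -
    obtain gp where gp: "\<And>t. U (c(VA i 1 := t)) = poly gp t"
      using poly_fun_upd_eq_poly[OF U] by blast
    obtain hp where hp: "\<And>t. V (c(Vl i 1 := t)) = poly hp t"
      using poly_fun_upd_eq_poly[OF V] by blast
    have "gp = 0"
      using on_hypersurface[OF c refl] unfolding gp hp by (rule poly_eq_0_if_eq_reciprocal_poly)
    then show ?thesis using gp[of "c (VA i 1)"] by simp
  qed
  have good_upd: "good (c(VA i 1 := t))" if "good c" for c t
    using that by (auto simp: good_def)
  \<comment> \<open>For nonzero \<open>\<kappa>\<close> the quotient \<open>\<kappa> / x\<close>
    runs through all nonzero numbers, so \<open>V\<close> has infinitely many zeros along the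
    coordinate \<open>p_i\<close>.\<close>
  have V0_generic: "V c = 0" if c: "good c" and \<kappa>: "c (Vl i 2) * c (VA i 2) \<noteq> 0" for c
  proof -
    obtain hp where hp: "\<And>t. V (c(Vl i 1 := t)) = poly hp t"
      using poly_fun_upd_eq_poly[OF V] by blast
    have "poly hp t = 0" if t: "t \<noteq> 0" for t
    proof -
      let ?k = "- (c (Vl i 2) * c (VA i 2))"
      have "?k / t \<noteq> 0" "?k / (?k / t) = t" using \<kappa> t by auto
      then have "t * poly hp t = 0"
        using on_hypersurface[OF c refl, of "?k / t"] U0[OF good_upd[OF c, of "?k / t"]] hp by simp
      then show ?thesis using t by simp
    qed
    then have "- {0} \<subseteq> {t. poly hp t = 0}" by auto
    moreover have "infinite (- {0} :: complex set)"
      using infinite_UNIV_char_0 finite_compl[of "{0 :: complex}"] by simp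
    ultimately have "hp = 0" using poly_roots_finite[of hp] finite_subset by blast
    then show ?thesis using hp[of "c (Vl i 1)"] by simp
  qed
  have V0: "V c = 0" if c: "good c" for c
  proof -
    \<comment> \<open>The case \<open>\<kappa> = 0\<close> is a limit of the generic one: shifting
      \<open>y_i\<close> and \<open>q_i\<close> by a small nonzero \<open>\<epsilon>\<close> makes
      their product nonzero.\<close>
    define ce where "ce \<epsilon> = c(VA i 2 := c (VA i 2) + \<epsilon>, Vl i 2 := c (Vl i 2) + \<epsilon>)" for \<epsilon>
    have "((\<lambda>\<epsilon>. ce \<epsilon> v) \<longlongrightarrow> c v) (at 0)" for v
    proof -
      have "((\<lambda>\<epsilon>. c v + \<epsilon>) \<longlongrightarrow> c v + 0) (at 0)" by (intro tendsto_intros)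
      then show ?thesis
        by (cases "v = VA i 2"; cases "v = Vl i 2") (simp_all add: ce_def)
    qed
    then have "((\<lambda>\<epsilon>. V (ce \<epsilon>)) \<longlongrightarrow> V c) (at 0)" by (rule poly_fun_tendsto[OF V])
    moreover have "\<forall>\<^sub>F \<epsilon> in at 0. poly ([:c (Vl i 2), 1:] * [:c (VA i 2), 1:]) \<epsilon> \<noteq> 0"
      by (rule eventually_poly_neq_0) (auto simp: pCons_eq_0_iff simp del: mult_pCons_left mult_pCons_right)
    then have "\<forall>\<^sub>F \<epsilon> in at 0. V (ce \<epsilon>) = 0"
    proof (rule eventually_mono)
      fix \<epsilon> assume "poly ([:c (Vl i 2), 1:] * [:c (VA i 2), 1:]) \<epsilon> \<noteq> 0"
      moreover have "good (ce \<epsilon>)" using c by (auto simp: good_def ce_def)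
      ultimately show "V (ce \<epsilon>) = 0"
        by (intro V0_generic) (simp_all add: ce_def poly_mult del: mult_pCons_left mult_pCons_right)
    qed
    then have "((\<lambda>\<epsilon>. V (ce \<epsilon>)) \<longlongrightarrow> 0) (at 0)" by (rule tendsto_eventually)
    ultimately show ?thesis by (metis tendsto_unique trivial_limit_at)
  qed
  have "P (hom_coord z) = fst (z i) $ 3 * g (hom_coord z)" if z: "z \<in> hom_U" for z
  proof -
    have "good (hom_coord z)" "pairing_coord (hom_coord z) i = 0"
      using z by (auto simp: good_def hom_U_def hom_M_iff)
    then show ?thesis using U0 V0 P_eq[of "hom_coord z"] by simp
  qed
  then show ?thesis using g by blast
qed

text \<open>The third row replaces \<open>w_i\<close> by \<open>w_i + t x_i + t^2 y_i\<close>. As a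
  polynomial in \<open>t\<close> this is nonzero unless \<open>A_i = 0\<close>, so one curve of
  unipotent matrices serves all points at once.\<close>

definition shear :: "complex \<Rightarrow> complex^3^3" where
  "shear t = vector [vector [1, 0, 0], vector [0, 1, 0], vector [t, t\<^sup>2, 1]]"

lemma det_shear [simp]: "det (shear t) = 1"
  by (simp add: shear_def det_3)

lemma SL_act_shear: "SL_act (shear t) z = (\<lambda>i.
   (vector [fst (z i) $ 1, fst (z i) $ 2, t * fst (z i) $ 1 + t\<^sup>2 * fst (z i) $ 2 + fst (z i) $ 3],
    vector [snd (z i) $ 1 - t * snd (z i) $ 3, snd (z i) $ 2 - t\<^sup>2 * snd (z i) $ 3, snd (z i) $ 3]))"
  by (simp add: SL_act_eq fun_eq_iff vec_eq_iff forall_3, simp add: shear_def adj_row_def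
      matrix_vector_mult_def sum_3)

lemma eventually_shear_hom_U:
  fixes z :: "'n::finite hom_point"
  assumes z: "z \<in> hom_reg"
  shows "\<forall>\<^sub>F t in at 0. SL_act (shear t) z \<in> hom_U"
proof -
  have "\<forall>\<^sub>F t in at 0. \<forall>i. poly [:fst (z i) $ 3, fst (z i) $ 1, fst (z i) $ 2:] t \<noteq> 0"
    using z by (intro eventually_all_finite eventually_poly_neq_0)
      (auto simp: hom_reg_def vec_eq_iff forall_3)
  then show ?thesis
  proof (rule eventually_mono)
    fix t assume *: "\<forall>i. poly [:fst (z i) $ 3, fst (z i) $ 1, fst (z i) $ 2:] t \<noteq> 0"
    have "SL_act (shear t) z \<in> hom_M" using z by (intro SL_act_hom_M) (auto simp: hom_reg_def)
    then show "SL_act (shear t) z \<in> hom_U"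
      using * by (simp add: hom_U_def SL_act_shear algebra_simps power2_eq_square)
  qed
qed

text \<open>\<open>shear 0\<close> is the identity, and the moved coordinates are polynomial in
  \<open>t\<close>.\<close>

lemma tendsto_shear:
  assumes "poly_fun S f"
  shows "((\<lambda>t. f (hom_coord (SL_act (shear t) z))) \<longlongrightarrow> f (hom_coord z)) (at 0)"
proof (rule poly_fun_tendsto[OF assms])
  fix v
  have "((\<lambda>t. t * a + t\<^sup>2 * b + c) \<longlongrightarrow> 0 * a + 0\<^sup>2 * b + c) (at 0)"
    "((\<lambda>t. a - t * b) \<longlongrightarrow> a - 0 * b) (at 0)"
    "((\<lambda>t. a - t\<^sup>2 * b) \<longlongrightarrow> a - 0\<^sup>2 * b) (at 0)" for a b c :: complex
    by (intro tendsto_intros)+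
  then have *: "((\<lambda>t. t * a + t\<^sup>2 * b + c) \<longlongrightarrow> c) (at 0)"
    "((\<lambda>t. a - t * b) \<longlongrightarrow> a) (at 0)"
    "((\<lambda>t. a - t\<^sup>2 * b) \<longlongrightarrow> a) (at 0)" for a b c :: complex
    by simp_all
  show "((\<lambda>t. hom_coord (SL_act (shear t) z) v) \<longlongrightarrow> hom_coord z v) (at 0)"
  proof (cases v)
    case (VA i j)
    have "\<forall>j. ((\<lambda>t. hom_coord (SL_act (shear t) z) (VA i j)) \<longlongrightarrow> hom_coord z (VA i j)) (at 0)"
      by (simp add: forall_3 SL_act_shear *)
    then show ?thesis using VA by blast
  next
    case (Vl i j)
    have "\<forall>j. ((\<lambda>t. hom_coord (SL_act (shear t) z) (Vl i j)) \<longlongrightarrow> hom_coord z (Vl i j)) (at 0)"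
      by (simp add: forall_3 SL_act_shear *)
    then show ?thesis using Vl by blast
  qed
qed

text \<open>The shears move a point of \<open>w\<^sub>i = 0\<close> into \<open>hom_U\<close>, and \<open>H\<close> is constant on the resulting
  curve, whereas the factor \<open>w\<^sub>i\<close> tends to \<open>0\<close>.\<close>

lemma numerator_vanishes:
  fixes F :: "('n::finite aff_var, real) mpoly"
  assumes F: "F \<in> proj_invariants"
  defines "H \<equiv> homogenize (\<lambda>z. mpoly_eval z (mpoly_of_real F))"
  assumes P: "poly_fun UNIV P"
    and eq: "\<And>z. z \<in> hom_U \<Longrightarrow> P (hom_coord z) = (\<Prod>j\<in>UNIV. fst (z j) $ 3 ^ e j) * H z"
    and e: "e i > 0" and z: "z \<in> hom_reg" "fst (z i) $ 3 = 0"
  shows "P (hom_coord z) = 0"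
proof -
  have ev: "\<forall>\<^sub>F t in at 0. SL_act (shear t) z \<in> hom_U" by (rule eventually_shear_hom_U[OF z(1)])
  then obtain t\<^sub>0 where t0: "SL_act (shear t\<^sub>0) z \<in> hom_U"
    using eventually_happens trivial_limit_at by blast
  define K where "K = H (SL_act (shear t\<^sub>0) z)"
  \<comment> \<open>With \<open>H\<close> replaced by its constant value \<open>K\<close>,
    hypothesis \<open>eq\<close> becomes a polynomial equation along the curve and survives the
    limit.\<close>
  define Q where "Q = (\<lambda>c :: 'n hom_var \<Rightarrow> complex. P c - (\<Prod>j\<in>UNIV. c (VA j 3) ^ e j) * K)"
  have Q: "poly_fun UNIV Q"
    unfolding Q_def by (intro poly_fun_intros P) auto
  have "\<forall>\<^sub>F t in at 0. Q (hom_coord (SL_act (shear t) z)) = 0"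
    using ev
  proof eventually_elim
    case (elim t)
    have "H (SL_act (shear t) z) = K"
      unfolding K_def H_def by (rule homogenize_SL_act_eq[OF F]) (use elim t0 in auto)
    then show ?case using eq[OF elim] by (simp add: Q_def)
  qed
  then have "((\<lambda>t. Q (hom_coord (SL_act (shear t) z))) \<longlongrightarrow> 0) (at 0)" by (rule tendsto_eventually)
  with tendsto_shear[OF Q, of z] have "Q (hom_coord z) = 0"
    by (metis tendsto_unique trivial_limit_at)
  moreover have "(\<Prod>j\<in>UNIV. hom_coord z (VA j 3) ^ e j) = 0"
    using e z(2) by (auto intro!: bexI[of _ i])
  ultimately show ?thesis by (simp add: Q_def)
qed

text \<open>Induction on the total exponent: as long as some \<open>e i\<close> is positive, the
  numerator vanishes on \<open>w_i = 0\<close> and \<open>poly_fun_divide_w\<close> cancels one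
  factor \<open>w_i\<close>.\<close>

lemma remove_poles:
  fixes F :: "('n::finite aff_var, real) mpoly"
  assumes F: "F \<in> proj_invariants"
  defines "H \<equiv> homogenize (\<lambda>z. mpoly_eval z (mpoly_of_real F))"
  assumes "poly_fun UNIV P"
    and "\<And>z. z \<in> hom_U \<Longrightarrow> P (hom_coord z) = (\<Prod>j\<in>UNIV. fst (z j) $ 3 ^ e j) * H z"
  shows "\<exists>Q. poly_fun UNIV Q \<and> (\<forall>z\<in>hom_U. Q (hom_coord z) = H z)"
  using assms(3-)
proof (induction "sum e UNIV" arbitrary: e P)
  case 0
  then have "e j = 0" for j by simp
  then show ?case using 0 by (intro exI[of _ P]) simp
next
  case (Suc k)
  have "\<exists>i. e i > 0"
  proof (rule ccontr)
    assume "\<not> (\<exists>i. e i > 0)"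
    then show False using Suc.hyps(2) by simp
  qed
  then obtain i where i: "e i > 0" by blast
  define e' where "e' = e(i := e i - 1)"
  have e: "e j = e' j + (if j = i then 1 else 0)" for j using i by (simp add: e'_def)
  have sum_e': "k = sum e' UNIV"
    using Suc.hyps(2) unfolding e by (simp add: sum.distrib)
  have "P (hom_coord z) = 0" if "z \<in> hom_reg" "fst (z i) $ 3 = 0" for z
    by (rule numerator_vanishes[OF F Suc.prems(1) Suc.prems(2)[unfolded H_def] i that])
  then obtain g where g: "poly_fun UNIV g"
    "\<And>z. z \<in> hom_U \<Longrightarrow> P (hom_coord z) = fst (z i) $ 3 * g (hom_coord z)"
    using poly_fun_divide_w[OF Suc.prems(1), of i] by blast
  show ?case
  proof (rule Suc.hyps(1)[OF sum_e' g(1)])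
    fix z :: "'n hom_point" assume z: "z \<in> hom_U"
    have "(\<Prod>j\<in>UNIV. fst (z j) $ 3 ^ e j)
        = (\<Prod>j\<in>UNIV. fst (z j) $ 3 ^ e' j) * (\<Prod>j\<in>UNIV. if j = i then fst (z j) $ 3 else 1)"
      unfolding prod.distrib[symmetric] by (intro prod.cong refl) (simp add: e)
    also have "(\<Prod>j\<in>UNIV. if j = i then fst (z j) $ 3 else 1) = fst (z i) $ 3" by simp
    finally have "fst (z i) $ 3 * g (hom_coord z)
        = fst (z i) $ 3 * ((\<Prod>j\<in>UNIV. fst (z j) $ 3 ^ e' j) * H z)"
      using Suc.prems(2)[OF z] g(2)[OF z] by simp
    then show "g (hom_coord z) = (\<Prod>j\<in>UNIV. fst (z j) $ 3 ^ e' j) * H z"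
      using z by (simp add: hom_U_def)
  qed
qed

lemma homogenize_polynomial:
  fixes F :: "('n::finite aff_var, real) mpoly"
  assumes F: "F \<in> proj_invariants"
  defines "H \<equiv> homogenize (\<lambda>z. mpoly_eval z (mpoly_of_real F))"
  shows "\<exists>Q. poly_fun UNIV Q \<and> (\<forall>z\<in>hom_U. Q (hom_coord z) = H z)"
proof -
  define f where "f = (\<lambda>z. mpoly_eval z (mpoly_of_real F))"
  define d where "d = (\<lambda>c :: 'n hom_var \<Rightarrow> complex. \<Prod>j\<in>UNIV. c (VA j 3))"
  have f: "poly_fun UNIV f" unfolding f_def by (rule poly_fun_mpoly_eval)
  have d: "poly_fun UNIV d" unfolding d_def by (intro poly_fun_intros) auto
  have "\<exists>g. poly_fun UNIV g \<and> (\<forall>c\<in>{c. d c \<noteq> 0}. aff_of (point_of c) v = g c / d c)" for v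
  proof -
    have xy: "\<exists>g. poly_fun UNIV g \<and> (\<forall>c\<in>{c. d c \<noteq> 0}. c (VA i j) / c (VA i 3) = g c / d c)" for i j
    proof (intro exI[of _ "\<lambda>c. c (VA i j) * (\<Prod>k\<in>UNIV - {i}. c (VA k 3))"] conjI ballI)
      show "poly_fun UNIV (\<lambda>c :: 'n hom_var \<Rightarrow> complex. c (VA i j) * (\<Prod>k\<in>UNIV - {i}. c (VA k 3)))"
        by (intro poly_fun_intros) auto
      fix c :: "'n hom_var \<Rightarrow> complex" assume "c \<in> {c. d c \<noteq> 0}"
      moreover have "d c = c (VA i 3) * (\<Prod>k\<in>UNIV - {i}. c (VA k 3))"
        unfolding d_def by (rule prod.remove) auto
      ultimately show "c (VA i j) / c (VA i 3) = c (VA i j) * (\<Prod>k\<in>UNIV - {i}. c (VA k 3)) / d c"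
        by simp
    qed
    \<comment> \<open>These components are polynomial already; multiplying and dividing by
      \<open>d\<close> only gives them the common shape.\<close>
    have pq: "\<exists>g. poly_fun UNIV g \<and> (\<forall>c\<in>{c. d c \<noteq> 0}. c (VA i 3) * c (Vl i j) = g c / d c)" for i j
      by (intro exI[of _ "\<lambda>c. c (VA i 3) * c (Vl i j) * d c"] conjI poly_fun_intros d) auto
    show ?thesis
      using xy pq by (cases v) (simp_all add: point_of_def)
  qed
  then have "\<exists>N g. poly_fun UNIV g \<and> (\<forall>c\<in>{c. d c \<noteq> 0}.
      f (\<lambda>v. aff_of (point_of c) v) = g c / d c ^ N)"
    by (rule poly_fun_clear_denominators[OF f d]) simp_all
  then obtain N g where g: "poly_fun UNIV g"
    "\<And>c. d c \<noteq> 0 \<Longrightarrow> f (aff_of (point_of c)) = g c / d c ^ N"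
    by blast
  show ?thesis
    unfolding H_def
  \<comment> \<open>The exponent \<open>N\<close> comes from clearing the denominators of
    \<open>aff_of\<close>, the additional 3 from the denominator of
    \<open>homogenize\<close>.\<close>
  proof (rule remove_poles[OF F g(1), where e = "\<lambda>_. N + 3"])
    fix z :: "'n hom_point" assume "z \<in> hom_U"
    then have "d (hom_coord z) \<noteq> 0" by (simp add: d_def hom_U_def)
    moreover from g(2)[OF this] have "f (aff_of z) = g (hom_coord z) / d (hom_coord z) ^ N"
      by simp
    moreover have "(\<Prod>j\<in>UNIV. fst (z j) $ 3 ^ k) = d (hom_coord z) ^ k" for k
      by (simp add: d_def prod_power_distrib)
    ultimately show "g (hom_coord z) = (\<Prod>j\<in>UNIV. fst (z j) $ 3 ^ (N + 3))
        * homogenize (\<lambda>z. mpoly_eval z (mpoly_of_real F)) z"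
      unfolding homogenize_def f_def[symmetric] by (simp only:) (simp add: power_add)
  qed
qed

section \<open>Homogeneous and affine invariants\<close>

text \<open>Density of \<open>hom_U\<close> in \<open>hom_M\<close>, by two limits: shears reach the
  points whose \<open>A_i\<close> are all nonzero, and lines inside the variety reach the
  others.\<close>

lemma poly_fun_zero_on_hom_M:
  fixes f :: "('n::finite hom_var \<Rightarrow> complex) \<Rightarrow> complex"
  assumes f: "poly_fun UNIV f" and zero: "\<And>z. z \<in> hom_U \<Longrightarrow> f (hom_coord z) = 0" and z: "z \<in> hom_M"
  shows "f (hom_coord z) = 0"
proof -
  have reg: "f (hom_coord z) = 0" if z: "z \<in> hom_reg" for z
  proof -
    have "\<forall>\<^sub>F t in at 0. f (hom_coord (SL_act (shear t) z)) = 0"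
      using eventually_shear_hom_U[OF z] by (rule eventually_mono) (rule zero)
    then show ?thesis
      using tendsto_shear[OF f, of z] tendsto_eventually tendsto_unique trivial_limit_at by metis
  qed
  \<comment> \<open>A direction for moving a vanishing \<open>A_i\<close>: a nonzero vector in the
    kernel of \<open>ell_i\<close>, so that the relation is preserved. Nonzero \<open>A_i\<close>
    are left in place.\<close>
  have "\<exists>B :: complex^3. (fst (z i) = 0 \<longrightarrow> B \<noteq> 0) \<and> (fst (z i) \<noteq> 0 \<longrightarrow> B = 0)
      \<and> snd (z i) $ 1 * B $ 1 + snd (z i) $ 2 * B $ 2 + snd (z i) $ 3 * B $ 3 = 0" for i
  proof (cases "fst (z i) = 0")
    case True
    show ?thesis
    proof (cases "snd (z i) $ 1 = 0 \<and> snd (z i) $ 2 = 0")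
      case True
      then show ?thesis using \<open>fst (z i) = 0\<close>
        by (intro exI[of _ "vector [1, 0, 0]"]) (simp add: vec_eq_iff forall_3)
    next
      case False
      then show ?thesis using \<open>fst (z i) = 0\<close>
        by (intro exI[of _ "vector [snd (z i) $ 2, - snd (z i) $ 1, 0]"])
          (auto simp add: vec_eq_iff forall_3)
    qed
  qed (auto intro: exI[of _ 0])
  then obtain B :: "'n \<Rightarrow> complex^3" where B: "\<And>i. fst (z i) = 0 \<Longrightarrow> B i \<noteq> 0"
    "\<And>i. fst (z i) \<noteq> 0 \<Longrightarrow> B i = 0"
    "\<And>i. snd (z i) $ 1 * B i $ 1 + snd (z i) $ 2 * B i $ 2 + snd (z i) $ 3 * B i $ 3 = 0"
    by metis
  define \<gamma> where "\<gamma> t = (\<lambda>i. (fst (z i) + t *s B i, snd (z i)))" for t :: complex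
  have \<gamma>_reg: "\<gamma> t \<in> hom_reg" if t: "t \<noteq> 0" for t
    unfolding hom_reg_def
  proof (intro CollectI conjI allI)
    show "\<gamma> t \<in> hom_M"
      unfolding hom_M_iff
    proof
      fix i
      have "snd (z i) $ 1 * fst (z i) $ 1 + snd (z i) $ 2 * fst (z i) $ 2 + snd (z i) $ 3 * fst (z i) $ 3 = 0"
        using z by (simp add: hom_M_iff)
      then show "snd (\<gamma> t i) $ 1 * fst (\<gamma> t i) $ 1 + snd (\<gamma> t i) $ 2 * fst (\<gamma> t i) $ 2
          + snd (\<gamma> t i) $ 3 * fst (\<gamma> t i) $ 3 = 0"
        using B(3)[of i] by (simp add: \<gamma>_def) algebra
    qed
    show "fst (\<gamma> t i) \<noteq> 0" for i
      using B(1,2)[of i] t by (cases "fst (z i) = 0") (auto simp: \<gamma>_def)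
  qed
  have "((\<lambda>t. f (hom_coord (\<gamma> t))) \<longlongrightarrow> f (hom_coord z)) (at 0)"
  proof (rule poly_fun_tendsto[OF f])
    fix v
    have "((\<lambda>t. a + t * b) \<longlongrightarrow> a + 0 * b) (at 0)" for a b :: complex
      by (intro tendsto_intros)
    then show "((\<lambda>t. hom_coord (\<gamma> t) v) \<longlongrightarrow> hom_coord z v) (at 0)"
      by (cases v) (simp_all add: \<gamma>_def)
  qed
  moreover have "\<forall>\<^sub>F t in at 0. f (hom_coord (\<gamma> t)) = 0"
    using \<gamma>_reg reg by (auto simp: eventually_at intro!: exI[of _ 1])
  ultimately show ?thesis
    using tendsto_eventually tendsto_unique trivial_limit_at by metis
qed

section \<open>The slice \<open>w_i = 1\<close> and the two group actions\<close>

definition aff_embed :: "('n aff_var \<Rightarrow> complex) \<Rightarrow> 'n hom_point" where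
  "aff_embed z = (\<lambda>i. (vector [z (Vx i), z (Vy i), 1], field_l z i))"

lemma aff_embed_hom_U: "aff_embed z \<in> hom_U"
  by (simp add: hom_U_def hom_M_iff aff_embed_def field_l_def)

lemma aff_of_aff_embed [simp]: "aff_of (aff_embed z) = z"
proof
  fix v show "aff_of (aff_embed z) v = z v"
    by (cases v) (simp_all add: aff_embed_def field_l_def)
qed

text \<open>Every torus orbit in \<open>hom_U\<close> meets the slice, so a function of given torus
  weight is determined on \<open>hom_U\<close> by its values there.\<close>

lemma torus_act_aff_embed:
  assumes "z \<in> hom_U"
  shows "torus_act (\<lambda>i. fst (z i) $ 3) (aff_embed (aff_of z)) = z"
proof
  fix i
  have w: "fst (z i) $ 3 \<noteq> 0"
    and rel: "snd (z i) $ 1 * fst (z i) $ 1 + snd (z i) $ 2 * fst (z i) $ 2 + snd (z i) $ 3 * fst (z i) $ 3 = 0"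
    using assms by (auto simp: hom_U_def hom_M_iff)
  from rel have "snd (z i) $ 3 * fst (z i) $ 3
      = - (snd (z i) $ 1 * fst (z i) $ 1) - snd (z i) $ 2 * fst (z i) $ 2" by algebra
  with w show "torus_act (\<lambda>i. fst (z i) $ 3) (aff_embed (aff_of z)) i = z i"
    by (simp add: torus_act_def aff_embed_def field_l_def prod_eq_iff vec_eq_iff forall_3 field_simps)
qed

lemma poly_fun_hom_act:
  assumes f: "poly_fun UNIV f" and "\<And>v. poly_fun UNIV (\<lambda>c. hom_coord (act (point_of c)) v)"
  shows "poly_fun UNIV (\<lambda>c. f (hom_coord (act (point_of c))))"
  using poly_fun_compose[OF f, of UNIV "\<lambda>v c. hom_coord (act (point_of c)) v"] assms(2) by simp

lemma poly_fun_torus_act: "poly_fun UNIV (\<lambda>c. hom_coord (torus_act t (point_of c)) v)"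
  by (cases v) (auto simp: torus_act_def point_of_def intro!: poly_fun_intros)

lemma poly_fun_SL_act:
  assumes "det G = 1"
  shows "poly_fun UNIV (\<lambda>c. hom_coord (SL_act G (point_of c)) v)"
proof (cases v)
  case (VA i j)
  show ?thesis
    unfolding VA SL_act_eq[OF assms] point_of_def
    by (simp add: matrix_vector_mult_def) (intro poly_fun_intros UNIV_I)
next
  case (Vl i j)
  have "\<forall>j. poly_fun UNIV (\<lambda>c. hom_coord (SL_act G (point_of c)) (Vl i j))"
    unfolding SL_act_eq[OF assms] point_of_def
    by (simp add: adj_row_def forall_3) (intro poly_fun_intros conjI UNIV_I)
  then show ?thesis unfolding Vl by blast
qed

lemma torus_act_hom_M:
  assumes t: "\<And>i. t i \<noteq> 0" and z: "z \<in> hom_M"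
  shows "torus_act t z \<in> hom_M"
  unfolding hom_M_iff
proof
  fix i
  show "snd (torus_act t z i) $ 1 * fst (torus_act t z i) $ 1
    + snd (torus_act t z i) $ 2 * fst (torus_act t z i) $ 2
    + snd (torus_act t z i) $ 3 * fst (torus_act t z i) $ 3 = 0"
    using t[of i] z unfolding hom_M_iff by (simp add: torus_act_def field_simps)
qed

lemma torus_act_hom_U: "(\<And>i. t i \<noteq> 0) \<Longrightarrow> z \<in> hom_U \<Longrightarrow> torus_act t z \<in> hom_U"
  using torus_act_hom_M by (auto simp: hom_U_def torus_act_def)

lemma hom_U_subset_hom_reg: "hom_U \<subseteq> hom_reg"
  by (auto simp: hom_U_def hom_reg_def) (metis zero_index)

lemma SL_act_hom_reg:
  assumes G: "det G = 1" and z: "z \<in> hom_reg"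
  shows "SL_act G z \<in> hom_reg"
  unfolding hom_reg_def
proof (intro CollectI conjI allI)
  show "SL_act G z \<in> hom_M" using z by (intro SL_act_hom_M G) (auto simp: hom_reg_def)
  fix i
  have inv: "invertible G" using G by (simp add: invertible_det_nz)
  have "matrix_inv G *v (G *v fst (z i)) = fst (z i)"
    by (simp add: matrix_vector_mul_assoc matrix_inv_both[OF inv])
  moreover have "fst (z i) \<noteq> 0" using z by (auto simp: hom_reg_def)
  ultimately have "G *v fst (z i) \<noteq> 0" by (metis matrix_vector_mult_0_right)
  then show "fst (SL_act G z i) \<noteq> 0" by (simp add: SL_act_def)
qed

text \<open>For \<open>z\<close> in \<open>hom_U\<close> the image under \<open>G\<close> may leave
  \<open>hom_U\<close>. A small shear brings it back, where invariance under
  \<open>shear t ** G\<close> applies, and \<open>t\<close> tends to 0. Density extends the identity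
  to \<open>hom_M\<close>.\<close>

lemma homogenize_extension_SL_act:
  fixes F :: "('n::finite aff_var, real) mpoly"
  assumes F: "F \<in> proj_invariants"
  defines "h \<equiv> homogenize (\<lambda>z. mpoly_eval z (mpoly_of_real F))"
  assumes Q: "poly_fun UNIV Q" and Qh: "\<And>z. z \<in> hom_U \<Longrightarrow> Q (hom_coord z) = h z"
    and G: "det G = 1" and z: "z \<in> hom_M"
  shows "Q (hom_coord (SL_act G z)) = Q (hom_coord z)"
proof -
  have U: "Q (hom_coord (SL_act G z)) = h z" if z: "z \<in> hom_U" for z
  proof -
    have "SL_act G z \<in> hom_reg"
      by (rule SL_act_hom_reg[OF G]) (use z hom_U_subset_hom_reg in blast)
    then have "\<forall>\<^sub>F t in at 0. SL_act (shear t) (SL_act G z) \<in> hom_U"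
      by (rule eventually_shear_hom_U)
    then have "\<forall>\<^sub>F t in at 0. Q (hom_coord (SL_act (shear t) (SL_act G z))) = h z"
    proof (rule eventually_mono)
      fix t assume t: "SL_act (shear t) (SL_act G z) \<in> hom_U"
      have K: "SL_act (shear t) (SL_act G z) = SL_act (shear t ** G) z"
        by (rule SL_act_mult[OF det_shear G])
      have "det (shear t ** G) = 1" by (simp add: det_mul G)
      then have "h (SL_act (shear t ** G) z) = h z"
        unfolding h_def by (rule homogenize_SL_act[OF F _ z t[unfolded K]])
      then show "Q (hom_coord (SL_act (shear t) (SL_act G z))) = h z"
        using Qh[OF t] unfolding K by simp
    qed
    then have "((\<lambda>t. Q (hom_coord (SL_act (shear t) (SL_act G z)))) \<longlongrightarrow> h z) (at 0)"
      by (rule tendsto_eventually)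
    from tendsto_unique[OF trivial_limit_at tendsto_shear[OF Q] this] show ?thesis .
  qed
  have "poly_fun UNIV (\<lambda>c. Q (hom_coord (SL_act G (point_of c))) - Q c)"
    by (rule poly_fun_diff[OF poly_fun_hom_act[OF Q poly_fun_SL_act[OF G]] Q])
  then have "Q (hom_coord (SL_act G (point_of (hom_coord z)))) - Q (hom_coord z) = 0"
    by (rule poly_fun_zero_on_hom_M[OF _ _ z]) (simp add: U Qh)
  then show ?thesis by simp
qed

text \<open>The torus leaves \<open>aff_of\<close> unchanged and multiplies the denominator by the
  cube of the product of the \<open>t_i\<close>; density again passes from \<open>hom_U\<close> to
  \<open>hom_M\<close>.\<close>

lemma homogenize_extension_torus_act:
  fixes F :: "('n::finite aff_var, real) mpoly"
  defines "h \<equiv> homogenize (\<lambda>z. mpoly_eval z (mpoly_of_real F))"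
  assumes Q: "poly_fun UNIV Q" and Qh: "\<And>z. z \<in> hom_U \<Longrightarrow> Q (hom_coord z) = h z"
    and t: "\<And>i. t i \<noteq> 0" and z: "z \<in> hom_M"
  shows "Q (hom_coord (torus_act t z)) = inverse ((\<Prod>i\<in>UNIV. t i) ^ 3) * Q (hom_coord z)"
proof -
  define k where "k = inverse ((\<Prod>i\<in>UNIV. t i) ^ 3)"
  have U: "h (torus_act t z) = k * h z" for z
  proof -
    have "aff_of (torus_act t z) = aff_of z"
    proof
      fix v show "aff_of (torus_act t z) v = aff_of z v"
        using t by (cases v) (simp_all add: torus_act_def)
    qed
    moreover have "(\<Prod>i\<in>UNIV. fst (torus_act t z i) $ 3 ^ 3)
        = (\<Prod>i\<in>UNIV. t i) ^ 3 * (\<Prod>i\<in>UNIV. fst (z i) $ 3 ^ 3)"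
      by (simp add: torus_act_def power_mult_distrib prod.distrib flip: prod_power_distrib)
    ultimately show ?thesis by (simp only: h_def homogenize_def k_def divide_inverse inverse_mult_distrib mult_ac)
  qed
  have "poly_fun UNIV (\<lambda>c. Q (hom_coord (torus_act t (point_of c))) - k * Q c)"
    by (rule poly_fun_diff[OF poly_fun_hom_act[OF Q poly_fun_torus_act] poly_fun_cmult[OF Q]])
  then have "Q (hom_coord (torus_act t (point_of (hom_coord z)))) - k * Q (hom_coord z) = 0"
    by (rule poly_fun_zero_on_hom_M[OF _ _ z]) (simp add: U Qh torus_act_hom_U[OF t])
  then show ?thesis by (simp add: k_def)
qed

lemma hom_W_exists:
  fixes F :: "('n::finite aff_var, real) mpoly"
  assumes F: "F \<in> proj_invariants"
  shows "\<exists>H\<in>hom_W. \<forall>r. H (aff_embed (\<lambda>v. of_real (r v))) = of_real (mpoly_eval r F)"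
proof -
  define h where "h = homogenize (\<lambda>z. mpoly_eval z (mpoly_of_real F))"
  obtain Q where Q: "poly_fun UNIV Q" and Qh: "\<And>z. z \<in> hom_U \<Longrightarrow> Q (hom_coord z) = h z"
    using homogenize_polynomial[OF F] unfolding h_def by blast
  obtain P where P: "Q = (\<lambda>c. mpoly_eval c P)" using poly_fun_imp_mpoly[OF Q] by blast
  define H where "H = (\<lambda>z. if z \<in> hom_M then Q (hom_coord z) else 0)"
  have "H \<in> hom_coord_ring"
    unfolding hom_coord_ring_def H_def P by (intro CollectI exI[of _ P] refl)
  moreover have "H (SL_act G z) = H z" if "det G = 1" "z \<in> hom_M" for G z
    using homogenize_extension_SL_act[OF F Q Qh[unfolded h_def] that] that SL_act_hom_M[OF that]
    by (simp add: H_def)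
  moreover have "H (torus_act t z) = inverse ((\<Prod>i\<in>UNIV. t i) ^ 3) * H z"
    if "\<And>i. t i \<noteq> 0" "z \<in> hom_M" for t z
    using homogenize_extension_torus_act[OF Q Qh[unfolded h_def] that] that(2) torus_act_hom_M[OF that]
    by (simp add: H_def)
  ultimately have "H \<in> hom_W" by (simp add: hom_W_def hom_SL_invariants_def)
  moreover have "H (aff_embed (\<lambda>v. of_real (r v))) = of_real (mpoly_eval r F)" for r
  proof -
    let ?z = "aff_embed (\<lambda>v. of_real (r v)) :: 'n hom_point"
    have "?z \<in> hom_U" by (rule aff_embed_hom_U)
    then have "H ?z = h ?z" using Qh by (simp add: H_def hom_U_def)
    moreover have "fst (?z i) $ 3 = 1" for i by (simp add: aff_embed_def)
    ultimately show ?thesis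
      by (simp add: h_def homogenize_def mpoly_eval_of_real)
  qed
  ultimately show ?thesis by blast
qed

lemma poly_fun_aff_embed:
  assumes "poly_fun UNIV P"
  shows "poly_fun UNIV (\<lambda>z. P (hom_coord (aff_embed z)))"
proof (rule poly_fun_compose[OF assms, of UNIV "\<lambda>v z. hom_coord (aff_embed z) v", simplified])
  fix v :: "'a hom_var"
  show "poly_fun UNIV (\<lambda>z. hom_coord (aff_embed z) v)"
  proof (cases v)
    case (VA i j)
    have "\<forall>j. poly_fun UNIV (\<lambda>z. hom_coord (aff_embed z) (VA i j))"
      by (simp add: aff_embed_def forall_3) (intro poly_fun_intros conjI UNIV_I)
    then show ?thesis unfolding VA by blast
  next
    case (Vl i j)
    have "\<forall>j. poly_fun UNIV (\<lambda>z. hom_coord (aff_embed z) (Vl i j))"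
      by (simp add: aff_embed_def field_l_def forall_3) (intro poly_fun_intros conjI UNIV_I)
    then show ?thesis unfolding Vl by blast
  qed
qed

lemma hom_W_poly_fun:
  assumes "H \<in> hom_W"
  shows "\<exists>P. poly_fun UNIV P \<and> H = (\<lambda>z. if z \<in> hom_M then P (hom_coord z) else 0)"
  using assms poly_fun_mpoly_eval by (auto simp: hom_W_def hom_SL_invariants_def hom_coord_ring_def)

lemma hom_W_torus:
  assumes "H \<in> hom_W" "z \<in> hom_M" "\<And>i. t i \<noteq> 0"
  shows "H (torus_act t z) = inverse ((\<Prod>i\<in>UNIV. t i) ^ 3) * H z"
  using assms by (simp add: hom_W_def)

text \<open>Agreement spreads in three stages: from real to complex points of the slice by Zariski
  density, to \<open>hom_U\<close> by the torus weight, and to \<open>hom_M\<close> by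
  density.\<close>

lemma hom_W_unique:
  fixes H H' :: "'n::finite hom_point \<Rightarrow> complex"
  assumes H: "H \<in> hom_W" and H': "H' \<in> hom_W"
    and eq: "\<And>r. H (aff_embed (\<lambda>v. of_real (r v))) = H' (aff_embed (\<lambda>v. of_real (r v)))"
  shows "H = H'"
proof -
  obtain P where P: "poly_fun UNIV P" and HP: "H = (\<lambda>z. if z \<in> hom_M then P (hom_coord z) else 0)"
    using hom_W_poly_fun[OF H] by blast
  obtain P' where P': "poly_fun UNIV P'" and HP': "H' = (\<lambda>z. if z \<in> hom_M then P' (hom_coord z) else 0)"
    using hom_W_poly_fun[OF H'] by blast
  have M: "aff_embed z \<in> hom_M" for z :: "'n aff_var \<Rightarrow> complex"
    using aff_embed_hom_U[of z] by (simp add: hom_U_def)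
  have "P (hom_coord (aff_embed z)) - P' (hom_coord (aff_embed z)) = 0" for z
  proof (rule poly_fun_zero_on_reals_imp_zero[of UNIV
        "\<lambda>z. P (hom_coord (aff_embed z)) - P' (hom_coord (aff_embed z))"])
    show "poly_fun UNIV (\<lambda>z. P (hom_coord (aff_embed z)) - P' (hom_coord (aff_embed z)))"
      by (intro poly_fun_diff poly_fun_aff_embed P P')
    show "P (hom_coord (aff_embed (\<lambda>v. of_real (r v)))) - P' (hom_coord (aff_embed (\<lambda>v. of_real (r v)))) = 0" for r
      using eq[of r] M by (simp add: HP HP')
  qed
  then have emb: "H (aff_embed z) = H' (aff_embed z)" for z
    using M by (simp add: HP HP')
  have U: "H z = H' z" if z: "z \<in> hom_U" for z
  proof -
    have t: "fst (z i) $ 3 \<noteq> 0" for i using z by (simp add: hom_U_def)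
    have "H (torus_act (\<lambda>i. fst (z i) $ 3) (aff_embed (aff_of z)))
        = H' (torus_act (\<lambda>i. fst (z i) $ 3) (aff_embed (aff_of z)))"
      by (simp add: hom_W_torus[OF H M t] hom_W_torus[OF H' M t] emb)
    then show ?thesis by (simp add: torus_act_aff_embed[OF z])
  qed
  have "P (hom_coord z) - P' (hom_coord z) = 0" if "z \<in> hom_M" for z
  proof (rule poly_fun_zero_on_hom_M[of "\<lambda>c. P c - P' c", OF _ _ that])
    show "poly_fun UNIV (\<lambda>c. P c - P' c)" by (intro poly_fun_diff P P')
    show "P (hom_coord z) - P' (hom_coord z) = 0" if "z \<in> hom_U" for z
      using U[OF that] that by (simp add: HP HP' hom_U_def)
  qed
  then show ?thesis by (auto simp: HP HP')
qed

text \<open>With \<open>G = T / c\<close> one has \<open>T A_i / s_i = (c / s_i) G A_i\<close> and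
  \<open>s_i ell_i T^(-1) = (c / s_i)^(-1) ell_i G^(-1)\<close>.\<close>

lemma aff_embed_aff_act:
  fixes r :: "'n aff_var \<Rightarrow> real"
  assumes T: "invertible T" and s: "\<And>i. aff_s T r i \<noteq> 0"
    and c: "c ^ 3 = det T"
  shows "aff_embed (\<lambda>v. of_real (aff_act T r v))
    = torus_act (\<lambda>i. of_real (c / aff_s T r i))
        (SL_act (mat_of_real ((1 / c) *\<^sub>R T)) (aff_embed (\<lambda>v. of_real (r v))))"
proof -
  have det: "det T \<noteq> 0" using T by (simp add: invertible_det_nz)
  then have c0: "c \<noteq> 0" using c by auto
  have "det ((1 / c) *\<^sub>R T) = det T / c ^ 3"
    by (simp add: det_3 power3_eq_cube algebra_simps divide_simps)
  then have G: "det (mat_of_real ((1 / c) *\<^sub>R T)) = 1"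
    using c det by (simp add: det_mat_of_real)
  have emb: "aff_embed (\<lambda>v. of_real (r v)) i
      = ((\<chi> j. of_real (aff_A r i $ j)), (\<chi> j. of_real (aff_l r i $ j)))" for r :: "'n aff_var \<Rightarrow> real" and i
    by (simp add: aff_embed_def field_l_def aff_A_def aff_l_def vec_eq_iff forall_3)
  have mv: "mat_of_real M *v (\<chi> j. of_real (a $ j)) = (\<chi> j. of_real ((M *v a) $ j))" for M a
    by (simp add: matrix_vector_mult_def vec_eq_iff)
  have adj: "adj_row (mat_of_real M) (\<chi> j. of_real (l $ j)) = (\<chi> j. of_real (adj_row M l $ j))" for M l
    by (simp add: adj_row_def vec_eq_iff forall_3)
  have adj_scale: "adj_row (k *\<^sub>R M) l = k\<^sup>2 *\<^sub>R adj_row M l" for k :: real and M :: "real^3^3" and l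
    by (simp add: adj_row_def vec_eq_iff forall_3 power2_eq_square algebra_simps)
  show ?thesis
  proof
    fix i
    \<comment> \<open>The adjugate of a 3 by 3 matrix is quadratic in its entries, which accounts
      for the square; the rest is \<open>det T = c^3\<close>.\<close>
    have E: "aff_s T r i / det T = inverse (c / aff_s T r i) * (1 / c)\<^sup>2"
      using c0 s[of i] unfolding c[symmetric] by (simp add: field_simps power2_eq_square power3_eq_cube)
    have l: "aff_l (aff_act T r) i $ j
        = inverse (c / aff_s T r i) * adj_row ((1 / c) *\<^sub>R T) (aff_l r i) $ j" for j
    proof -
      have "aff_l (aff_act T r) i $ j = (aff_s T r i / det T) * adj_row T (aff_l r i) $ j"
        by (simp add: aff_l_act[OF T s] vector_matrix_inv_eq[OF det])
      then show ?thesis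
        by (simp only: E adj_scale vector_scaleR_component real_scaleR_def mult.assoc)
    qed
    have A: "aff_A (aff_act T r) i $ j = (c / aff_s T r i) * (((1 / c) *\<^sub>R T) *v aff_A r i) $ j" for j
      using c0 by (simp add: aff_A_act[OF s] scaleR_matrix_vector_assoc[symmetric])
    show "aff_embed (\<lambda>v. of_real (aff_act T r v)) i = torus_act (\<lambda>i. of_real (c / aff_s T r i))
        (SL_act (mat_of_real ((1 / c) *\<^sub>R T)) (aff_embed (\<lambda>v. of_real (r v)))) i"
      unfolding torus_act_def SL_act_eq[OF G] emb
      by (simp only: fst_conv snd_conv mv adj)
        (simp add: vec_eq_iff A l del: times_divide_eq_left times_divide_eq_right divide_inverse)
  qed
qed

lemma proj_invariants_of_hom_W:
  fixes H :: "'n::finite hom_point \<Rightarrow> complex"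
  assumes H: "H \<in> hom_W"
  shows "\<exists>F\<in>proj_invariants. \<exists>G\<in>proj_invariants. \<forall>r. H (aff_embed (\<lambda>v. of_real (r v)))
    = of_real (mpoly_eval r F) + \<i> * of_real (mpoly_eval r G)"
proof -
  obtain P where P: "poly_fun UNIV P" and HP: "H = (\<lambda>z. if z \<in> hom_M then P (hom_coord z) else 0)"
    using hom_W_poly_fun[OF H] by blast
  have M: "aff_embed z \<in> hom_M" for z :: "'n aff_var \<Rightarrow> complex"
    using aff_embed_hom_U[of z] by (simp add: hom_U_def)
  obtain Q where Q: "(\<lambda>z. P (hom_coord (aff_embed z))) = (\<lambda>z. mpoly_eval z Q)"
    using poly_fun_imp_mpoly[OF poly_fun_aff_embed[OF P]] by blast
  obtain F G where FG: "\<And>r. mpoly_eval (\<lambda>v. of_real (r v)) Q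
      = of_real (mpoly_eval r F) + \<i> * of_real (mpoly_eval r G)"
    using mpoly_complex_split[of Q] by blast
  have HFG: "H (aff_embed (\<lambda>v. of_real (r v)))
      = of_real (mpoly_eval r F) + \<i> * of_real (mpoly_eval r G)" for r
    using M by (simp add: HP FG[symmetric] Q[THEN fun_cong])
  have act: "mpoly_eval (aff_act T r) F = inverse (aff_J T r) * mpoly_eval r F
      \<and> mpoly_eval (aff_act T r) G = inverse (aff_J T r) * mpoly_eval r G"
    if T: "invertible T" and s: "\<And>i. aff_s T r i \<noteq> 0" for T r
  proof -
    \<comment> \<open>Cube roots of negative reals are real, so every invertible real
      \<open>T\<close> can be scaled to determinant 1 over the reals.\<close>
    define c where "c = root 3 (det T)"
    have c: "c ^ 3 = det T" by (simp add: c_def odd_real_root_pow)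
    have det: "det T \<noteq> 0" using T by (simp add: invertible_det_nz)
    then have c0: "c \<noteq> 0" using c by auto
    let ?G = "mat_of_real ((1 / c) *\<^sub>R T)"
    have "det ((1 / c) *\<^sub>R T) = det T / c ^ 3"
      by (simp add: det_3 power3_eq_cube algebra_simps divide_simps)
    then have G: "det ?G = 1" using c det by (simp add: det_mat_of_real)
    have "(\<Prod>i\<in>UNIV. complex_of_real (c / aff_s T r i)) ^ 3 = of_real (aff_J T r)"
      by (simp add: aff_J_def c[symmetric] prod_dividef power_divide prod_power_distrib power_mult[symmetric]
          mult.commute)
    then have "H (aff_embed (\<lambda>v. of_real (aff_act T r v)))
        = of_real (inverse (aff_J T r)) * H (SL_act ?G (aff_embed (\<lambda>v. of_real (r v))))"
      unfolding aff_embed_aff_act[OF T s c]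
      by (subst hom_W_torus[OF H SL_act_hom_M[OF G M]]) (use c0 s in auto)
    also have "H (SL_act ?G (aff_embed (\<lambda>v. of_real (r v)))) = H (aff_embed (\<lambda>v. of_real (r v)))"
      using H G M by (simp add: hom_W_def hom_SL_invariants_def)
    finally have eq: "of_real (mpoly_eval (aff_act T r) F) + \<i> * of_real (mpoly_eval (aff_act T r) G)
      = of_real (inverse (aff_J T r)) * (of_real (mpoly_eval r F) + \<i> * of_real (mpoly_eval r G))"
      unfolding HFG .
    \<comment> \<open>The weight factor is real, so the transformation law splits into real and
      imaginary parts.\<close>
    have "a = j * a' \<and> b = j * b'"
      if "of_real a + \<i> * of_real b = of_real j * (of_real a' + \<i> * of_real b')" for a b j a' b' :: real
      using that by (simp add: complex_eq_iff)
    from this[OF eq] show ?thesis .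
  qed
  then have "F \<in> proj_invariants" "G \<in> proj_invariants" by (auto simp: proj_invariants_def)
  then show ?thesis using HFG by blast
qed

section \<open>Complexification\<close>

abbreviation basis_elt :: "'a \<Rightarrow> 'a \<Rightarrow>\<^sub>0 'k::comm_ring_1" where
  "basis_elt k \<equiv> Poly_Mapping.single k 1"

lemma poly_mapping_eq_sum_single:
  "x = (\<Sum>k\<in>Poly_Mapping.keys x. Poly_Mapping.single k (Poly_Mapping.lookup x k))"
proof (rule poly_mapping_eqI)
  fix k
  have "Poly_Mapping.lookup (\<Sum>k\<in>Poly_Mapping.keys x. Poly_Mapping.single k (Poly_Mapping.lookup x k)) k
      = (\<Sum>l\<in>Poly_Mapping.keys x. if l = k then Poly_Mapping.lookup x l else 0)"
    unfolding lookup_sum by (intro sum.cong refl) (simp only: lookup_single when_def)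
  also have "\<dots> = Poly_Mapping.lookup x k"
    by (simp only: sum.delta finite_keys in_keys_iff) simp
  finally show "Poly_Mapping.lookup x k
    = Poly_Mapping.lookup (\<Sum>k\<in>Poly_Mapping.keys x. Poly_Mapping.single k (Poly_Mapping.lookup x k)) k" ..
qed

lemma subspace_tensor_null: "module.subspace pm_scale (tensor_null sV V sW W)"
  unfolding tensor_null_def by (rule module.subspace_span[OF module_pm_scale])

lemmas tensor_null_add = module.subspace_add[OF module_pm_scale subspace_tensor_null]
  and tensor_null_diff = module.subspace_diff[OF module_pm_scale subspace_tensor_null]
  and tensor_null_scale = module.subspace_scale[OF module_pm_scale subspace_tensor_null]
  and tensor_null_zero = module.subspace_0[OF module_pm_scale subspace_tensor_null]

lemma tensor_rels_subset_null: "x \<in> tensor_rels sV V sW W \<Longrightarrow> x \<in> tensor_null sV V sW W"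
  unfolding tensor_null_def by (rule module.span_base[OF module_pm_scale])

lemma tensor_null_add_left:
  "u \<in> V \<Longrightarrow> v \<in> V \<Longrightarrow> w \<in> W \<Longrightarrow>
    basis_elt (u + v, w) - basis_elt (u, w) - basis_elt (v, w) \<in> tensor_null sV V sW W"
  by (rule tensor_rels_subset_null) (unfold tensor_rels_def, blast)

lemma tensor_null_add_right:
  "v \<in> V \<Longrightarrow> w \<in> W \<Longrightarrow> x \<in> W \<Longrightarrow>
    basis_elt (v, w + x) - basis_elt (v, w) - basis_elt (v, x) \<in> tensor_null sV V sW W"
  by (rule tensor_rels_subset_null) (unfold tensor_rels_def, blast)

lemma tensor_null_scale_left:
  "v \<in> V \<Longrightarrow> w \<in> W \<Longrightarrow>
    basis_elt (sV c v, w) - pm_scale c (basis_elt (v, w)) \<in> tensor_null sV V sW W"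
  by (rule tensor_rels_subset_null) (unfold tensor_rels_def, blast)

lemma tensor_null_scale_right:
  "v \<in> V \<Longrightarrow> w \<in> W \<Longrightarrow>
    basis_elt (v, sW c w) - pm_scale c (basis_elt (v, w)) \<in> tensor_null sV V sW W"
  by (rule tensor_rels_subset_null) (unfold tensor_rels_def, blast)

text \<open>Writing \<open>b = Re b + Im b * \<i>\<close> and moving real scalars into the left
  factor brings \<open>v \<otimes> b\<close> to the form
  \<open>f \<otimes> 1 + g \<otimes> \<i>\<close>, and this form is stable under sums.\<close>

lemma complexification_split:
  fixes sV :: "real \<Rightarrow> 'v::ab_group_add \<Rightarrow> 'v" and x :: "'v \<times> complex \<Rightarrow>\<^sub>0 real"
  assumes "module sV" and V: "module.subspace sV V" and x: "Poly_Mapping.keys x \<subseteq> V \<times> UNIV"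
  shows "\<exists>f\<in>V. \<exists>g\<in>V. x - basis_elt (f, 1) - basis_elt (g, \<i>) \<in> tensor_null sV V scaleR UNIV"
proof -
  interpret V: module sV by fact
  interpret pm: module "pm_scale :: real \<Rightarrow> ('v \<times> complex \<Rightarrow>\<^sub>0 real) \<Rightarrow> _" by (rule module_pm_scale)
  let ?N = "tensor_null sV V scaleR (UNIV :: complex set)"
  define D where "D = {x. \<exists>f\<in>V. \<exists>g\<in>V. x - basis_elt (f, 1) - basis_elt (g, \<i>) \<in> ?N}"
  have zero: "basis_elt (0, w) \<in> ?N" for w
    using tensor_null_scale_left[of 0 V w UNIV sV 0 scaleR] V.subspace_0[OF V] by simp
  have D_I: "x \<in> D" if "f \<in> V" "g \<in> V" "x - basis_elt (f, 1) - basis_elt (g, \<i>) \<in> ?N" for x f g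
    using that unfolding D_def by blast
  have D0: "0 \<in> D"
    by (rule D_I[OF V.subspace_0[OF V] V.subspace_0[OF V]
          tensor_null_diff[OF tensor_null_diff[OF tensor_null_zero zero] zero]])
  have D_add: "y + z \<in> D" if yz: "y \<in> D" "z \<in> D" for y z
  proof -
    obtain f g f' g' where V': "f \<in> V" "g \<in> V" "f' \<in> V" "g' \<in> V"
      and y: "y - basis_elt (f, 1) - basis_elt (g, \<i>) \<in> ?N"
      and z: "z - basis_elt (f', 1) - basis_elt (g', \<i>) \<in> ?N"
      using yz unfolding D_def by blast
    have "(y - basis_elt (f, 1) - basis_elt (g, \<i>)) + (z - basis_elt (f', 1) - basis_elt (g', \<i>))
        - (basis_elt (f + f', 1) - basis_elt (f, 1) - basis_elt (f', 1))
        - (basis_elt (g + g', \<i>) - basis_elt (g, \<i>) - basis_elt (g', \<i>)) \<in> ?N"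
      by (rule tensor_null_diff[OF tensor_null_diff[OF tensor_null_add[OF y z]
            tensor_null_add_left[OF V'(1,3) UNIV_I]] tensor_null_add_left[OF V'(2,4) UNIV_I]])
    also have "(y - basis_elt (f, 1) - basis_elt (g, \<i>)) + (z - basis_elt (f', 1) - basis_elt (g', \<i>))
        - (basis_elt (f + f', 1) - basis_elt (f, 1) - basis_elt (f', 1))
        - (basis_elt (g + g', \<i>) - basis_elt (g, \<i>) - basis_elt (g', \<i>))
      = (y + z) - basis_elt (f + f', 1) - basis_elt (g + g', \<i>)"
      by simp
    finally show ?thesis
      by (rule D_I[OF V.subspace_add[OF V V'(1,3)] V.subspace_add[OF V V'(2,4)]])
  qed
  have D_single: "Poly_Mapping.single (v, b) c \<in> D" if v: "v \<in> V" for v b c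
  proof -
    let ?a = "basis_elt (v, 1)" and ?a' = "basis_elt (v, \<i>)"
    let ?c1 = "c * Re b" and ?c2 = "c * Im b"
    \<comment> \<open>Five relations: \<open>?r1\<close> splits \<open>b\<close>, \<open>?r2\<close>
      and \<open>?r3\<close> extract its real coordinates, \<open>?r4\<close> and \<open>?r5\<close>
      absorb the resulting scalars into \<open>v\<close>.\<close>
    let ?r1 = "basis_elt (v, Re b *\<^sub>R 1 + Im b *\<^sub>R \<i>) - basis_elt (v, Re b *\<^sub>R 1)
        - basis_elt (v, Im b *\<^sub>R \<i>) :: 'v \<times> complex \<Rightarrow>\<^sub>0 real"
    let ?r2 = "basis_elt (v, Re b *\<^sub>R 1) - pm_scale (Re b) ?a :: 'v \<times> complex \<Rightarrow>\<^sub>0 real"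
    let ?r3 = "basis_elt (v, Im b *\<^sub>R \<i>) - pm_scale (Im b) ?a' :: 'v \<times> complex \<Rightarrow>\<^sub>0 real"
    let ?r4 = "basis_elt (sV ?c1 v, 1) - pm_scale ?c1 ?a :: 'v \<times> complex \<Rightarrow>\<^sub>0 real"
    let ?r5 = "basis_elt (sV ?c2 v, \<i>) - pm_scale ?c2 ?a' :: 'v \<times> complex \<Rightarrow>\<^sub>0 real"
    have b: "b = Re b *\<^sub>R 1 + Im b *\<^sub>R \<i>" by (simp add: complex_eq_iff)
    have single: "Poly_Mapping.single (v, b) c = pm_scale c (basis_elt (v, b))"
      by (rule poly_mapping_eqI) (simp add: lookup_single when_def)
    have "pm_scale c (?r1 + ?r2 + ?r3) - ?r4 - ?r5 \<in> ?N"
      by (rule tensor_null_diff[OF tensor_null_diff[OF tensor_null_scale[OF tensor_null_add[OF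
            tensor_null_add[OF tensor_null_add_right tensor_null_scale_right]
            tensor_null_scale_right]] tensor_null_scale_left] tensor_null_scale_left])
        (rule v UNIV_I)+
    also have "?r1 + ?r2 + ?r3 = basis_elt (v, b) - pm_scale (Re b) ?a - pm_scale (Im b) ?a'"
      unfolding b[symmetric] by simp
    also have "pm_scale c (basis_elt (v, b) - pm_scale (Re b) ?a - pm_scale (Im b) ?a') - ?r4 - ?r5
        = Poly_Mapping.single (v, b) c - basis_elt (sV ?c1 v, 1) - basis_elt (sV ?c2 v, \<i>)"
      unfolding single by (simp add: pm.scale_right_diff_distrib)
    finally show ?thesis
      by (rule D_I[OF V.subspace_scale[OF V v] V.subspace_scale[OF V v]])
  qed
  have "(\<Sum>k\<in>K. Poly_Mapping.single k (Poly_Mapping.lookup x k)) \<in> D"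
    if "finite K" "K \<subseteq> V \<times> UNIV" for K
    using that by (induction K) (auto intro: D0 D_add D_single)
  from this[OF finite_keys x] have "x \<in> D"
    unfolding poly_mapping_eq_sum_single[symmetric] .
  then show ?thesis by (simp add: D_def)
qed

text \<open>The real linear extension of \<open>v \<otimes> b \<mapsto> b * e v\<close>. For real
  linear \<open>e\<close> it descends to the tensor product, by
  \<open>tensor_eval_null\<close>.\<close>

definition tensor_eval :: "('v \<Rightarrow> complex) \<Rightarrow> ('v \<times> complex \<Rightarrow>\<^sub>0 real) \<Rightarrow> complex" where
  "tensor_eval e x = (\<Sum>k\<in>Poly_Mapping.keys x. of_real (Poly_Mapping.lookup x k) * (snd k * e (fst k)))"

lemma tensor_eval_superset:
  "finite S \<Longrightarrow> Poly_Mapping.keys x \<subseteq> S \<Longrightarrow>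
    tensor_eval e x = (\<Sum>k\<in>S. of_real (Poly_Mapping.lookup x k) * (snd k * e (fst k)))"
  unfolding tensor_eval_def by (rule sum.mono_neutral_left) (auto simp: in_keys_iff)

lemma tensor_eval_add: "tensor_eval e (x + y) = tensor_eval e x + tensor_eval e y"
proof -
  let ?S = "Poly_Mapping.keys x \<union> Poly_Mapping.keys y"
  show ?thesis
    by (simp add: tensor_eval_superset[of ?S] keys_add lookup_add distrib_right sum.distrib)
qed

lemma tensor_eval_scale: "tensor_eval e (pm_scale c x) = of_real c * tensor_eval e x"
proof -
  have "Poly_Mapping.keys (pm_scale c x) \<subseteq> Poly_Mapping.keys x" by (auto simp: in_keys_iff)
  then show ?thesis
    by (simp add: tensor_eval_superset[of "Poly_Mapping.keys x"] sum_distrib_left mult.assoc)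
qed

lemma tensor_eval_zero: "tensor_eval e 0 = 0"
  by (simp add: tensor_eval_def)

lemma tensor_eval_diff: "tensor_eval e (x - y) = tensor_eval e x - tensor_eval e y"
  using tensor_eval_add[of e "x - y" y] by simp

lemma tensor_eval_single:
  "tensor_eval e (Poly_Mapping.single (v, b) c) = of_real c * (b * e v)"
  by (simp add: tensor_eval_def)

lemma tensor_eval_sum: "tensor_eval e (\<Sum>i\<in>I. x i) = (\<Sum>i\<in>I. tensor_eval e (x i))"
  by (induction I rule: infinite_finite_induct) (auto simp: tensor_eval_zero tensor_eval_add)

lemma tensor_eval_free_cscale: "tensor_eval e (free_cscale a x) = a * tensor_eval e x"
  unfolding free_cscale_def tensor_eval_sum
  by (simp add: tensor_eval_def[of e x] sum_distrib_left case_prod_beta tensor_eval_single mult_ac)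

lemma tensor_eval_null:
  assumes e: "\<And>u v. e (u + v) = e u + e v" "\<And>c v. e (sV c v) = of_real c * e v"
    and x: "x \<in> tensor_null sV V scaleR UNIV"
  shows "tensor_eval e x = 0"
proof -
  have "module.subspace pm_scale {x. tensor_eval e x = 0}"
    by (rule module.subspaceI[OF module_pm_scale])
      (auto simp: tensor_eval_zero tensor_eval_add tensor_eval_scale)
  moreover have "tensor_rels sV V scaleR UNIV \<subseteq> {x. tensor_eval e x = 0}"
    by (auto simp: tensor_rels_def tensor_eval_diff tensor_eval_single tensor_eval_scale e
        distrib_left distrib_right mult.assoc mult.left_commute scaleR_conv_of_real)
  ultimately show ?thesis
    using x module.span_minimal[OF module_pm_scale] unfolding tensor_null_def by blast
qed

section \<open>Comparison of both spaces through functions on real affine points\<close>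

definition real_embed :: "('n aff_var \<Rightarrow> real) \<Rightarrow> 'n hom_point" where
  "real_embed r = aff_embed (\<lambda>v. of_real (r v))"

definition tensor_fun :: "(('v, real) mpoly \<times> complex \<Rightarrow>\<^sub>0 real) \<Rightarrow> ('v \<Rightarrow> real) \<Rightarrow> complex" where
  "tensor_fun x r = tensor_eval (\<lambda>F. of_real (mpoly_eval r F)) x"

lemma tensor_fun_null:
  assumes "x \<in> tensor_null pm_scale V scaleR UNIV"
  shows "tensor_fun x r = 0"
  unfolding tensor_fun_def using assms
  by (rule tensor_eval_null[rotated -1]) (simp_all add: mpoly_eval_add mpoly_eval_scale)

lemma tensor_fun_basis_elts:
  "tensor_fun (basis_elt (F, 1) + basis_elt (G, \<i>)) r
    = of_real (mpoly_eval r F) + \<i> * of_real (mpoly_eval r G)"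
  by (simp add: tensor_fun_def tensor_eval_add tensor_eval_single)

lemma tensor_fun_split:
  fixes x :: "('n::finite aff_var, real) mpoly \<times> complex \<Rightarrow>\<^sub>0 real"
  assumes x: "Poly_Mapping.keys x \<subseteq> proj_invariants \<times> UNIV"
  obtains F G where "F \<in> proj_invariants" "G \<in> proj_invariants"
    "x - basis_elt (F, 1) - basis_elt (G, \<i>) \<in> tensor_null pm_scale proj_invariants scaleR UNIV"
    "\<And>r. tensor_fun x r = of_real (mpoly_eval r F) + \<i> * of_real (mpoly_eval r G)"
proof -
  obtain F G where FG: "F \<in> proj_invariants" "G \<in> proj_invariants"
    and N: "x - basis_elt (F, 1) - basis_elt (G, \<i>) \<in> tensor_null pm_scale proj_invariants scaleR UNIV"
    using complexification_split[OF module_pm_scale subspace_proj_invariants x] by blast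
  have "tensor_fun x r = of_real (mpoly_eval r F) + \<i> * of_real (mpoly_eval r G)" for r
    using tensor_fun_null[OF N, of r] tensor_fun_basis_elts[of F G r]
    by (simp add: tensor_fun_def tensor_eval_diff tensor_eval_add tensor_eval_single) algebra
  then show ?thesis using that FG N by blast
qed

text \<open>The source of injectivity: for \<open>f \<otimes> 1 + g \<otimes> \<i>\<close> the real
  and imaginary parts vanish at all real points, so both polynomials are zero.\<close>

lemma tensor_fun_zero_imp_null:
  fixes x :: "('n::finite aff_var, real) mpoly \<times> complex \<Rightarrow>\<^sub>0 real"
  assumes x: "Poly_Mapping.keys x \<subseteq> proj_invariants \<times> UNIV" and zero: "\<And>r. tensor_fun x r = 0"
  shows "x \<in> tensor_null pm_scale proj_invariants scaleR UNIV"
proof -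
  let ?N = "tensor_null pm_scale (proj_invariants :: ('n aff_var, real) mpoly set) scaleR (UNIV :: complex set)"
  obtain F G where FG: "F \<in> proj_invariants" "G \<in> proj_invariants"
    and N: "x - basis_elt (F, 1) - basis_elt (G, \<i>) \<in> ?N"
    and fn: "\<And>r. tensor_fun x r = of_real (mpoly_eval r F) + \<i> * of_real (mpoly_eval r G)"
    using tensor_fun_split[OF x] by blast
  have "mpoly_eval r F = 0 \<and> mpoly_eval r G = 0" for r
    using fn[of r] zero[of r] by (simp add: complex_eq_iff)
  then have F: "F = 0" and G: "G = 0" by (auto intro!: mpoly_eq_0)
  have "basis_elt (0, w) \<in> ?N" for w
  proof -
    have "pm_scale 0 F = 0" "pm_scale 0 (basis_elt (F, w)) = (0 :: _ \<Rightarrow>\<^sub>0 real)"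
      by (rule poly_mapping_eqI, simp)+
    then show ?thesis
      using tensor_null_scale_left[OF FG(1), of w UNIV pm_scale 0 scaleR] by simp
  qed
  then have "(x - basis_elt (F, 1) - basis_elt (G, \<i>)) + basis_elt (G, \<i>) + basis_elt (F, 1) \<in> ?N"
    by (intro tensor_null_add N) (simp_all add: F G)
  then show ?thesis by simp
qed

lemma hom_W_lincomb:
  fixes H H' :: "'n::finite hom_point \<Rightarrow> complex"
  assumes H: "H \<in> hom_W" and H': "H' \<in> hom_W"
  shows "(\<lambda>z. a * H z + b * H' z) \<in> hom_W"
proof -
  have "H \<in> hom_coord_ring" "H' \<in> hom_coord_ring"
    using assms by (auto simp: hom_W_def hom_SL_invariants_def)
  then obtain P P' :: "('n hom_var, complex) mpoly"
    where P: "H = (\<lambda>z. if z \<in> hom_M then mpoly_eval (hom_coord z) P else 0)"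
      and P': "H' = (\<lambda>z. if z \<in> hom_M then mpoly_eval (hom_coord z) P' else 0)"
    unfolding hom_coord_ring_def by blast
  have "(\<lambda>z. a * H z + b * H' z)
      = (\<lambda>z. if z \<in> hom_M then mpoly_eval (hom_coord z) (pm_scale a P + pm_scale b P') else 0)"
    unfolding P P' by (auto simp: mpoly_eval_add mpoly_eval_scale)
  then have "(\<lambda>z. a * H z + b * H' z) \<in> hom_coord_ring"
    unfolding hom_coord_ring_def by blast
  then show ?thesis
    using assms by (auto simp: hom_W_def hom_SL_invariants_def algebra_simps)
qed

text \<open>The description is unambiguous by \<open>hom_W_unique\<close>; for functions arising
  from tensors of invariants, \<open>hom_of_tensor_fun\<close> supplies existence.\<close>

definition hom_of_real_fun :: "(('n::finite aff_var \<Rightarrow> real) \<Rightarrow> complex) \<Rightarrow> 'n hom_point \<Rightarrow> complex" where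
  "hom_of_real_fun f = (THE H. H \<in> hom_W \<and> (\<forall>r. H (real_embed r) = f r))"

lemma hom_of_real_fun_eqI:
  assumes "H \<in> hom_W" "\<And>r. H (real_embed r) = f r"
  shows "hom_of_real_fun f = H"
  unfolding hom_of_real_fun_def
proof (rule the_equality)
  show "H' = H" if "H' \<in> hom_W \<and> (\<forall>r. H' (real_embed r) = f r)" for H'
    using that assms by (intro hom_W_unique) (auto simp: real_embed_def)
qed (use assms in auto)

lemma hom_of_tensor_fun:
  assumes "Poly_Mapping.keys x \<subseteq> proj_invariants \<times> UNIV"
  shows "hom_of_real_fun (tensor_fun x) \<in> hom_W \<and>
    (\<forall>r. hom_of_real_fun (tensor_fun x) (real_embed r) = tensor_fun x r)"
proof -
  obtain F G where FG: "F \<in> proj_invariants" "G \<in> proj_invariants"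
    "\<And>r. tensor_fun x r = of_real (mpoly_eval r F) + \<i> * of_real (mpoly_eval r G)"
    using tensor_fun_split[OF assms] by blast
  obtain H H' where H: "H \<in> hom_W" "\<And>r. H (real_embed r) = of_real (mpoly_eval r F)"
    and H': "H' \<in> hom_W" "\<And>r. H' (real_embed r) = of_real (mpoly_eval r G)"
    using hom_W_exists[OF FG(1)] hom_W_exists[OF FG(2)] unfolding real_embed_def by blast
  have W: "(\<lambda>z. 1 * H z + \<i> * H' z) \<in> hom_W" by (rule hom_W_lincomb[OF H(1) H'(1)])
  have "hom_of_real_fun (tensor_fun x) = (\<lambda>z. 1 * H z + \<i> * H' z)"
    by (rule hom_of_real_fun_eqI[OF W]) (simp add: H H' FG)
  then show ?thesis using W by (simp add: H H' FG)
qed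

theorem theorem3p1:
  assumes "CARD('n::finite) \<ge> 3"
  shows "\<exists>\<phi> :: (('n aff_var, real) mpoly \<times> complex \<Rightarrow>\<^sub>0 real) set
              \<Rightarrow> 'n hom_point \<Rightarrow> complex.
    bij_betw \<phi> (complexification pm_scale proj_invariants) hom_W \<and>
    (\<forall>X\<in>complexification pm_scale proj_invariants.
       \<forall>Y\<in>complexification pm_scale proj_invariants.
         \<phi> (X + Y) = (\<lambda>z. \<phi> X z + \<phi> Y z)) \<and>
    (\<forall>a. \<forall>X\<in>complexification pm_scale proj_invariants.
       \<phi> (complexification_scale pm_scale proj_invariants a X) = (\<lambda>z. a * \<phi> X z))"
proof -
  let ?C = "complexification pm_scale (proj_invariants :: ('n aff_var, real) mpoly set)"
  let ?V = "proj_invariants :: ('n aff_var, real) mpoly set"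
  let ?N = "tensor_null pm_scale ?V scaleR (UNIV :: complex set)"
  \<comment> \<open>The choice of representative has no influence, because \<open>tensor_fun\<close>
    is constant on each coset; see \<open>coset\<close> below.\<close>
  define \<phi> where "\<phi> = (\<lambda>X. hom_of_real_fun (tensor_fun (SOME x :: ('n aff_var, real) mpoly \<times> complex \<Rightarrow>\<^sub>0 real. x \<in> X)))"
  have \<phi>: "\<phi> X = hom_of_real_fun f" if "x \<in> X" "\<And>x. x \<in> X \<Longrightarrow> tensor_fun x = f" for x X f
    using that(2)[of "SOME x. x \<in> X"] someI[of "\<lambda>x. x \<in> X"] that(1) by (simp add: \<phi>_def)
  have tensor_fun_add: "tensor_fun (x + y) = (\<lambda>r. tensor_fun x r + tensor_fun y r)"
    for x y :: "('n aff_var, real) mpoly \<times> complex \<Rightarrow>\<^sub>0 real"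
    by (simp add: fun_eq_iff tensor_fun_def tensor_eval_add)
  have coset: "\<exists>x. Poly_Mapping.keys x \<subseteq> ?V \<times> UNIV \<and> X = x +o ?N \<and> x \<in> X
      \<and> (\<forall>y\<in>X. tensor_fun y = tensor_fun x)" if X: "X \<in> ?C" for X
  proof -
    obtain x where x: "Poly_Mapping.keys x \<subseteq> ?V \<times> UNIV" "X = x +o ?N"
      using X unfolding complexification_def tensor_prod_def by blast
    have "x + 0 \<in> x +o ?N" by (rule set_plus_intro2[OF tensor_null_zero])
    then have "x \<in> x +o ?N" by simp
    moreover have "tensor_fun y = tensor_fun x" if y: "y \<in> x +o ?N" for y
    proof -
      obtain n where "n \<in> ?N" "y = x + n" using y unfolding elt_set_plus_def by blast
      then show ?thesis by (simp add: tensor_fun_add tensor_fun_null)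
    qed
    ultimately show ?thesis using x(1) unfolding x(2) by blast
  qed
  have in_C: "x +o ?N \<in> ?C" if "Poly_Mapping.keys x \<subseteq> ?V \<times> UNIV" for x
    using that unfolding complexification_def tensor_prod_def by blast
  have \<phi>_coset: "\<phi> X = hom_of_real_fun (tensor_fun x)"
    if X: "X \<in> ?C" and x: "x \<in> X" for X x
  proof -
    obtain x' where "\<forall>y\<in>X. tensor_fun y = tensor_fun x'" using coset[OF X] by blast
    then have "tensor_fun y = tensor_fun x" if "y \<in> X" for y using that x by metis
    then show ?thesis by (rule \<phi>[OF x])
  qed
  have "inj_on \<phi> ?C"
  proof (rule inj_onI)
    fix X Y assume X: "X \<in> ?C" and Y: "Y \<in> ?C" and eq: "\<phi> X = \<phi> Y"
    obtain x where x: "Poly_Mapping.keys x \<subseteq> ?V \<times> UNIV" "X = x +o ?N" "x \<in> X" using coset[OF X] by blast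
    obtain y where y: "Poly_Mapping.keys y \<subseteq> ?V \<times> UNIV" "Y = y +o ?N" "y \<in> Y" using coset[OF Y] by blast
    have "tensor_fun (x - y) r = 0" for r
    proof -
      have "tensor_fun x r = hom_of_real_fun (tensor_fun x) (real_embed r)"
        using hom_of_tensor_fun[OF x(1)] by simp
      also have "hom_of_real_fun (tensor_fun x) = hom_of_real_fun (tensor_fun y)"
        using eq unfolding \<phi>_coset[OF X x(3)] \<phi>_coset[OF Y y(3)] .
      also have "hom_of_real_fun (tensor_fun y) (real_embed r) = tensor_fun y r"
        using hom_of_tensor_fun[OF y(1)] by simp
      finally show ?thesis by (simp add: tensor_fun_def tensor_eval_diff)
    qed
    moreover have "Poly_Mapping.keys (x - y) \<subseteq> ?V \<times> UNIV"
      using x(1) y(1) keys_diff[of x y] by blast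
    ultimately have xy: "x - y \<in> ?N" by (intro tensor_fun_zero_imp_null)
    \<comment> \<open>Adding or subtracting the null element \<open>x - y\<close> passes between the
      two descriptions, so the cosets coincide.\<close>
    have "x + n \<in> y +o ?N \<and> y + n \<in> x +o ?N" if n: "n \<in> ?N" for n
      using set_plus_intro2[OF tensor_null_add[OF n xy], of y]
        set_plus_intro2[OF tensor_null_diff[OF n xy], of x]
      by (simp add: algebra_simps)
    then show "X = Y" unfolding x(2) y(2) elt_set_plus_def by blast
  qed
  moreover have "\<phi> ` ?C = hom_W"
  proof
    show "\<phi> ` ?C \<subseteq> hom_W"
    proof
      fix H assume "H \<in> \<phi> ` ?C"
      then obtain X where X: "X \<in> ?C" "H = \<phi> X" by blast
      obtain x where x: "Poly_Mapping.keys x \<subseteq> ?V \<times> UNIV" "x \<in> X" using coset[OF X(1)] by blast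
      then show "H \<in> hom_W"
        using hom_of_tensor_fun[OF x(1)] unfolding X(2) \<phi>_coset[OF X(1) x(2)] by blast
    qed
    show "hom_W \<subseteq> \<phi> ` ?C"
    proof
      fix H :: "'n hom_point \<Rightarrow> complex" assume H: "H \<in> hom_W"
      obtain F G where FG: "F \<in> proj_invariants" "G \<in> proj_invariants"
        "\<And>r. H (real_embed r) = of_real (mpoly_eval r F) + \<i> * of_real (mpoly_eval r G)"
        using proj_invariants_of_hom_W[OF H] unfolding real_embed_def by blast
      \<comment> \<open>The preimage of \<open>H\<close> is the coset of
        \<open>F \<otimes> 1 + G \<otimes> \<i>\<close>, built from its real and imaginary parts on
        the slice.\<close>
      define x where "x = (basis_elt (F, 1) + basis_elt (G, \<i>) :: _ \<Rightarrow>\<^sub>0 real)"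
      have "Poly_Mapping.keys x \<subseteq> {(F, 1), (G, \<i>)}"
        unfolding x_def by (rule order_trans[OF keys_add]) auto
      then have keys: "Poly_Mapping.keys x \<subseteq> ?V \<times> UNIV" using FG by auto
      have "x + 0 \<in> x +o ?N" by (rule set_plus_intro2[OF tensor_null_zero])
      then have "\<phi> (x +o ?N) = hom_of_real_fun (tensor_fun x)"
        using \<phi>_coset[OF in_C[OF keys]] by simp
      also have "\<dots> = H"
        by (rule hom_of_real_fun_eqI[OF H]) (simp add: FG x_def tensor_fun_basis_elts)
      finally show "H \<in> \<phi> ` ?C" using in_C[OF keys] by blast
    qed
  qed
  ultimately have "bij_betw \<phi> ?C hom_W" by (simp add: bij_betw_def)
  moreover have "\<phi> (X + Y) = (\<lambda>z. \<phi> X z + \<phi> Y z)" if X: "X \<in> ?C" and Y: "Y \<in> ?C" for X Y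
  proof -
    obtain x where x: "Poly_Mapping.keys x \<subseteq> ?V \<times> UNIV" "x \<in> X" "\<forall>y\<in>X. tensor_fun y = tensor_fun x"
      using coset[OF X] by blast
    obtain y where y: "Poly_Mapping.keys y \<subseteq> ?V \<times> UNIV" "y \<in> Y" "\<forall>x\<in>Y. tensor_fun x = tensor_fun y"
      using coset[OF Y] by blast
    note hx = hom_of_tensor_fun[OF x(1)] and hy = hom_of_tensor_fun[OF y(1)]
    have "\<phi> (X + Y) = hom_of_real_fun (tensor_fun (x + y))"
    proof (rule \<phi>)
      show "x + y \<in> X + Y" using x(2) y(2) by (rule set_plus_intro)
      fix z assume "z \<in> X + Y"
      then obtain x' y' where xy': "x' \<in> X" "y' \<in> Y" "z = x' + y'" by (rule set_plus_elim)
      have "tensor_fun x' = tensor_fun x" "tensor_fun y' = tensor_fun y"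
        using x(3) y(3) xy' by blast+
      then show "tensor_fun z = tensor_fun (x + y)" by (simp add: xy'(3) tensor_fun_add)
    qed
    also have "\<dots> = (\<lambda>z. 1 * hom_of_real_fun (tensor_fun x) z + 1 * hom_of_real_fun (tensor_fun y) z)"
      by (rule hom_of_real_fun_eqI[OF hom_W_lincomb]) (use hx hy in \<open>simp_all add: tensor_fun_add\<close>)
    finally show ?thesis
      using \<phi>_coset[OF X x(2)] \<phi>_coset[OF Y y(2)] by simp
  qed
  moreover have "\<phi> (complexification_scale pm_scale proj_invariants a X) = (\<lambda>z. a * \<phi> X z)"
    if X: "X \<in> ?C" for a X
  proof -
    obtain x where x: "Poly_Mapping.keys x \<subseteq> ?V \<times> UNIV" "x \<in> X" "\<forall>y\<in>X. tensor_fun y = tensor_fun x"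
      using coset[OF X] by blast
    note hx = hom_of_tensor_fun[OF x(1)]
    have "\<phi> (complexification_scale pm_scale proj_invariants a X)
        = hom_of_real_fun (\<lambda>r. a * tensor_fun x r)"
    \<comment> \<open>The scaled coset is a union over all representatives of \<open>X\<close>; it
      suffices that it is inhabited and that \<open>tensor_fun\<close> is the same on all of
      it.\<close>
    proof (rule \<phi>)
      have "free_cscale a x + 0 \<in> free_cscale a x +o ?N"
        by (rule set_plus_intro2[OF tensor_null_zero])
      then show "free_cscale a x \<in> complexification_scale pm_scale proj_invariants a X"
        unfolding complexification_scale_def using x(2) by auto
      fix y assume "y \<in> complexification_scale pm_scale proj_invariants a X"
      then obtain x' n where x': "x' \<in> X" "n \<in> ?N" "y = free_cscale a x' + n"
        unfolding complexification_scale_def elt_set_plus_def by blast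
      have "tensor_fun x' = tensor_fun x" using x(3) x'(1) by blast
      moreover have "tensor_fun (free_cscale a x') = (\<lambda>r. a * tensor_fun x' r)"
        by (simp add: fun_eq_iff tensor_fun_def tensor_eval_free_cscale)
      ultimately show "tensor_fun y = (\<lambda>r. a * tensor_fun x r)"
        by (simp add: x'(3) tensor_fun_add tensor_fun_null[OF x'(2)])
    qed
    \<comment> \<open>The summand with coefficient 0 presents the scalar multiple as a linear
      combination, as \<open>hom_W_lincomb\<close> expects.\<close>
    also have "\<dots> = (\<lambda>z. a * hom_of_real_fun (tensor_fun x) z + 0 * hom_of_real_fun (tensor_fun x) z)"
      by (rule hom_of_real_fun_eqI[OF hom_W_lincomb]) (use hx in simp_all)
    finally show ?thesis
      using \<phi>_coset[OF X x(2)] by simp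
  qed
  ultimately show ?thesis by blast
qed

end
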